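(* Let $(D,\{\pi_k\}_{k\ge1})$ be a homotopy matching dendriform algebra. Then the following hold. (i) The pair $(D\otimes\mathbb K[X],\{\mu_k\}_{k\ge1})$ is an $A_\infty$-algebra, where $$\mu_k(a_1\otimes x_1,\dots,a_k\otimes x_k):=\sum_{r=1}^k\big((\pi_k)^{[r]}_{x_1,\dots,x_k}(a_1,\dots,a_k)\big)\otimes x_r,\quad a_i\otimes x_i\in D\otimes\mathbb K[X].$$ (ii) The graded module $D$ can be given a bimodule structure over the $A_\infty$-algebra $(D\otimes\mathbb K[X],\{\mu_k\}_{k\ge1})$ with the action maps $\{\eta_k\}_{k\ge1}$ given by $$\eta_k(a_1\otimes x_1,\dots,a_r,\dots,a_k\otimes x_k):=(\pi_k)^{[r]}_{x_1,\dots,x_k}(a_1,\dots,a_k),$$ for $a_i\otimes x_i\in D\otimes\mathbb K[X]$ $(i=1,\dots,r-1,r+1,\dots,k)$ and $a_r\in D$, where on the right hand side $x_r$ is any element of $X$. (iii) The triple $\big((D\otimes\mathbb K[X],\{\mu_k\}_{k\ge1}),(D,\{\eta_k\}_{k\ge1}),\{P_x\}_{x\in X}\big)$ is a homotopy matching relative Rota-Baxter algebra, where $P_x:D\to D\otimes\mathbb K[X]$ are the degree $0$ linear maps $P_x(a):=a\otimes x$, for $a\in D$ and $x\in X$. Moreover, the induced homotopy matching dendriform algebra structure on $D$ coincides with the given one.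
   Context: $\mathbb K$ is a commutative unital ring with $\mathrm{char}\,\mathbb K\neq 2$; all modules, linear maps, Hom spaces and tensor products are over $\mathbb K$; $X$ is a nonempty set; $\mathbb K[X]$ is the free $\mathbb K$-module with basis $X$, placed in degree $0$; $|a|$ is the degree of a homogeneous element $a$. For a graded $\mathbb K$-module $D$, let $C_k=\{[1],\dots,[k]\}$ and let $\mathcal O_D(k)$ be the set of families $f=\oplus_{x_1,\dots,x_k\in X}f_{x_1,\dots,x_k}$, $f_{x_1,\dots,x_k}\in\mathrm{Hom}(\mathbb K[C_k]\otimes D^{\otimes k},D)$ ($\mathbb K[C_k]$ the free module on $C_k$), such that $f^{[r]}_{x_1,\dots,x_k}:=f_{x_1,\dots,x_k}([r];-,\dots,-)$ does not depend on $x_r$ for $1\le r\le k$. A homotopy matching dendriform algebra is a pair $(D,\{\pi_k\}_{k\ge1})$ with $D=\oplus_{i\in\mathbb Z}D^i$ and $\pi_k\in\mathcal O_D(k)$, $\deg((\pi_k)^{[r]}_{x_1,\dots,x_k})=k-2$, such that for all $n\ge1$, homogeneous $a_1,\dots,a_n\in D$, $x_1,\dots,x_n\in X$, $[r]\in C_n$, $$\sum_{k+l=n+1}\sum_{i=1}^k(-1)^{i(l+1)+l(|a_1|+\cdots+|a_{i-1}|)}(\pi_k\circ_i\pi_l)^{[r]}_{x_1,\dots,x_n}(a_1,\dots,a_n)=0,$$ where for $f\in\mathcal O_D(k)$, $g\in\mathcal O_D(l)$ the term $(f\circ_ig)^{[r]}_{x_1,\dots,x_{k+l-1}}(a_1,\dots,a_{k+l-1})$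 is - if $1\le r\le i-1$: $\sum_{s=1}^lf^{[r]}_{x_1,\dots,x_{i-1},x_{i-1+s},x_{i+l},\dots,x_{k+l-1}}(a_1,\dots,a_{i-1},g^{[s]}_{x_i,\dots,x_{i+l-1}}(a_i,\dots,a_{i+l-1}),a_{i+l},\dots,a_{k+l-1})$; - if $i\le r\le i+l-1$: $f^{[i]}_{x_1,\dots,x_{i-1},x_r,x_{i+l},\dots,x_{k+l-1}}(a_1,\dots,a_{i-1},g^{[r-i+1]}_{x_i,\dots,x_{i+l-1}}(a_i,\dots,a_{i+l-1}),a_{i+l},\dots,a_{k+l-1})$; - if $i+l\le r\le k+l-1$: $\sum_{s=1}^lf^{[r-l+1]}_{x_1,\dots,x_{i-1},x_{i-1+s},x_{i+l},\dots,x_{k+l-1}}(a_1,\dots,a_{i-1},g^{[s]}_{x_i,\dots,x_{i+l-1}}(a_i,\dots,a_{i+l-1}),a_{i+l},\dots,a_{k+l-1})$. (No further Koszul signs are introduced in these substitutions.) An $A_\infty$-algebra is a graded $\mathbb K$-module $A=\oplus_{i\in\mathbb Z}A^i$ with graded linear maps $\mu_k:A^{\otimes k}\to A$, $\deg\mu_k=k-2$ $(k\ge1)$, such that for all $n\ge1$ and homogeneous $a_1,\dots,a_n$, $$\sum_{k+l=n+1}\sum_{i=1}^k(-1)^{i(l+1)+l(|a_1|+\cdots+|a_{i-1}|)}\mu_k(a_1,\dots,a_{i-1},\mu_l(a_i,\dots,a_{i+l-1}),a_{i+l},\dots,a_n)=0.\quad( * )$$ A bimodule (representation) of it is a graded $\mathbb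 K$-module $M$ with graded linear maps $\eta_k:\mathcal A^{k-1,1}\to M$, $\deg\eta_k=k-2$ $(k\ge1)$, where $\mathcal A^{k-1,1}$ is the direct sum of all $k$-fold tensor products of $A$ and $M$ with $A$ appearing $k-1$ times and $M$ exactly once, satisfying $( * )$ when exactly one of $a_1,\dots,a_n$ comes from $M$ and each operation $\mu_k$ or $\mu_l$ having an input from $M$ is replaced by $\eta_k$ or $\eta_l$. A homotopy matching relative Rota-Baxter algebra is a triple $(A,M,\{P_x\}_{x\in X})$ with $(A,\{\mu_k\})$ an $A_\infty$-algebra, $(M,\{\eta_k\})$ a bimodule over it and $P_x:M\to A$ degree $0$ linear maps such that $\mu_k(P_{x_1}(u_1),\dots,P_{x_k}(u_k))=\sum_{r=1}^kP_{x_r}(\eta_k(P_{x_1}(u_1),\dots,u_r,\dots,P_{x_k}(u_k)))$ for all $k\ge1$, $u_i\in M$, $x_i\in X$. The homotopy matching dendriform algebra it induces on $M$ is given by $(\pi_k)^{[r]}_{x_1,\dots,x_k}(u_1,\dots,u_k)=\eta_k(P_{x_1}(u_1),\dots,u_r,\dots,P_{x_k}(u_k))$. *)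

theory Defs
  imports Complex_Main "HOL-Library.Poly_Mapping"
begin

section \<open>Free modules and tensor products\<close>

definition free_scale :: "'k::comm_ring_1 \<Rightarrow> ('b \<Rightarrow>\<^sub>0 'k) \<Rightarrow> ('b \<Rightarrow>\<^sub>0 'k)" where
  "free_scale c p = Poly_Mapping.map ((*) c) p"

definition free_lift :: "('k::comm_ring_1 \<Rightarrow> 'e::ab_group_add \<Rightarrow> 'e) \<Rightarrow> ('b \<Rightarrow> 'e) \<Rightarrow> ('b \<Rightarrow>\<^sub>0 'k) \<Rightarrow> 'e" where
  "free_lift s f p = (\<Sum>z\<in>Poly_Mapping.keys p. s (Poly_Mapping.lookup p z) (f z))"

definition bilinear_map ::
  "('k::comm_ring_1 \<Rightarrow> 'm::ab_group_add \<Rightarrow> 'm) \<Rightarrow> ('k \<Rightarrow> 'n::ab_group_add \<Rightarrow> 'n)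
    \<Rightarrow> ('k \<Rightarrow> 'e::ab_group_add \<Rightarrow> 'e) \<Rightarrow> ('m \<Rightarrow> 'n \<Rightarrow> 'e) \<Rightarrow> bool" where
  "bilinear_map sM sN sE \<beta> \<longleftrightarrow>
    (\<forall>a. module_hom sN sE (\<beta> a)) \<and> (\<forall>b. module_hom sM sE (\<lambda>a. \<beta> a b))"

definition bilinear_relations ::
  "('k::comm_ring_1 \<Rightarrow> 'm::ab_group_add \<Rightarrow> 'm) \<Rightarrow> ('k \<Rightarrow> 'n::ab_group_add \<Rightarrow> 'n)
    \<Rightarrow> ('m \<times> 'n \<Rightarrow>\<^sub>0 'k) set" where
  "bilinear_relations sM sN =
     {Poly_Mapping.single (a + a', b) 1 - Poly_Mapping.single (a, b) 1 - Poly_Mapping.single (a', b) 1 | a a' b. True}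
   \<union> {Poly_Mapping.single (a, b + b') 1 - Poly_Mapping.single (a, b) 1 - Poly_Mapping.single (a, b') 1 | a b b'. True}
   \<union> {Poly_Mapping.single (sM c a, b) 1 - Poly_Mapping.single (a, b) c | c a b. True}
   \<union> {Poly_Mapping.single (a, sN c b) 1 - Poly_Mapping.single (a, b) c | c a b. True}"

text \<open>
  The tensor product of two modules is the free module on their product divided by the
  bilinearity relations. Since a type cannot depend on the scalar multiplications, the
  following locale describes the pairs consisting of a module and a map \<open>\<otimes>\<close> that present
  this quotient: the linear extension of \<open>\<otimes>\<close> to the free module is onto, and its kernel is the
  submodule generated by the relations. The universal property is derived below.
\<close>

locale tensor_product =
  M: module sM + N: module sN + T: module sT
  for sM :: "'k::comm_ring_1 \<Rightarrow> 'm::ab_group_add \<Rightarrow> 'm"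
    and sN :: "'k \<Rightarrow> 'n::ab_group_add \<Rightarrow> 'n"
    and sT :: "'k \<Rightarrow> 't::ab_group_add \<Rightarrow> 't" +
  fixes tensor :: "'m \<Rightarrow> 'n \<Rightarrow> 't"
  assumes onto: "range (free_lift sT (\<lambda>(a, b). tensor a b)) = UNIV"
    and kernel: "{p. free_lift sT (\<lambda>(a, b). tensor a b) p = 0}
      = module.span free_scale (bilinear_relations sM sN)"

lemma lookup_free_scale [simp]:
  "Poly_Mapping.lookup (free_scale c p) z = c * Poly_Mapping.lookup p z"
  by (simp add: free_scale_def Poly_Mapping.map.rep_eq when_def)

lemma module_free_scale: "module free_scale"
  by standard (auto intro!: poly_mapping_eqI simp: lookup_add algebra_simps)

lemma free_scale_single [simp]:
  "free_scale c (Poly_Mapping.single z d) = Poly_Mapping.single z (c * d)"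
  by (rule poly_mapping_eqI) (simp add: lookup_single when_def)

context module
begin

lemma free_lift_superset:
  assumes "finite S" "Poly_Mapping.keys p \<subseteq> S"
  shows "free_lift scale f p = (\<Sum>z\<in>S. Poly_Mapping.lookup p z *s f z)"
  unfolding free_lift_def
  using assms by (intro sum.mono_neutral_left) (auto simp: in_keys_iff)

lemma free_lift_single [simp]: "free_lift scale f (Poly_Mapping.single z c) = c *s f z"
  using free_lift_superset[of "{z}" "Poly_Mapping.single z c" f] by simp

lemma module_hom_free_lift: "module_hom free_scale scale (free_lift scale f)"
proof -
  interpret F: module free_scale by (rule module_free_scale)
  show ?thesis
  proof
    fix p q :: "'c \<Rightarrow>\<^sub>0 'a" and c :: 'a
    let ?S = "Poly_Mapping.keys p \<union> Poly_Mapping.keys q"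
    have "Poly_Mapping.keys (p + q) \<subseteq> ?S" by (rule Poly_Mapping.keys_add)
    then show "free_lift scale f (p + q) = free_lift scale f p + free_lift scale f q"
      by (simp add: free_lift_superset[of ?S] lookup_add scale_left_distrib sum.distrib)
    have "Poly_Mapping.keys (free_scale c p) \<subseteq> Poly_Mapping.keys p"
      by (auto simp: in_keys_iff)
    then show "free_lift scale f (free_scale c p) = c *s free_lift scale f p"
      by (simp add: free_lift_superset[of "Poly_Mapping.keys p"] scale_sum_right)
  qed
qed

end

lemma free_expand: "p = free_lift free_scale (\<lambda>z. Poly_Mapping.single z 1) p"
proof (rule poly_mapping_eqI)
  fix z
  show "Poly_Mapping.lookup p z =
    Poly_Mapping.lookup (free_lift free_scale (\<lambda>z. Poly_Mapping.single z 1) p) z"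
    by (cases "z \<in> Poly_Mapping.keys p")
      (simp_all add: free_lift_def lookup_sum lookup_single when_def in_keys_iff)
qed

lemma module_hom_free_eq_0_iff_span:
  assumes "module_hom free_scale s h" "\<And>z. z \<in> R \<Longrightarrow> h z = 0"
    and "p \<in> module.span free_scale R"
  shows "h p = 0"
proof -
  interpret h: module_hom free_scale s h by fact
  have "h.m1.subspace {p. h p = 0}"
    by (auto simp: h.m1.subspace_def h.add h.scale)
  then have "h.m1.span R \<subseteq> {p. h p = 0}"
    using assms(2) by (intro h.m1.span_minimal) auto
  with assms(3) show ?thesis by auto
qed

context tensor_product
begin

interpretation F: module "free_scale :: 'k \<Rightarrow> ('m \<times> 'n \<Rightarrow>\<^sub>0 'k) \<Rightarrow> _"
  by (rule module_free_scale)

lemma lift_relation: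
  "p \<in> bilinear_relations sM sN \<Longrightarrow> free_lift sT (\<lambda>(a, b). tensor a b) p = 0"
  using kernel F.span_base by blast

lemma bilinear: "bilinear_map sM sN sT tensor"
proof -
  interpret L: module_hom free_scale sT "free_lift sT (\<lambda>(a, b). tensor a b)"
    by (rule T.module_hom_free_lift)
  have 1: "tensor (a + a') b = tensor a b + tensor a' b" for a a' b
  proof -
    have "Poly_Mapping.single (a + a', b) 1 - Poly_Mapping.single (a, b) 1 - Poly_Mapping.single (a', b) 1
        \<in> bilinear_relations sM sN"
      unfolding bilinear_relations_def by blast
    from lift_relation[OF this] show ?thesis by (simp add: L.diff diff_eq_eq add.commute)
  qed
  have 2: "tensor a (b + b') = tensor a b + tensor a b'" for a b b'
  proof -
    have "Poly_Mapping.single (a, b + b') 1 - Poly_Mapping.single (a, b) 1 - Poly_Mapping.single (a, b') 1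
        \<in> bilinear_relations sM sN"
      unfolding bilinear_relations_def by blast
    from lift_relation[OF this] show ?thesis by (simp add: L.diff diff_eq_eq add.commute)
  qed
  have 3: "tensor (sM c a) b = sT c (tensor a b)" for c a b
  proof -
    have "Poly_Mapping.single (sM c a, b) 1 - Poly_Mapping.single (a, b) c
        \<in> bilinear_relations sM sN"
      unfolding bilinear_relations_def by blast
    from lift_relation[OF this] show ?thesis by (simp add: L.diff diff_eq_eq add.commute)
  qed
  have 4: "tensor a (sN c b) = sT c (tensor a b)" for c a b
  proof -
    have "Poly_Mapping.single (a, sN c b) 1 - Poly_Mapping.single (a, b) c
        \<in> bilinear_relations sM sN"
      unfolding bilinear_relations_def by blast
    from lift_relation[OF this] show ?thesis by (simp add: L.diff diff_eq_eq add.commute)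
  qed
  show ?thesis
    unfolding bilinear_map_def
    by (auto intro!: module_hom.intro module_hom_axioms.intro M.module_axioms N.module_axioms
        T.module_axioms simp: 1 2 3 4)
qed

theorem universal_property:
  fixes sE :: "'k \<Rightarrow> 'e::ab_group_add \<Rightarrow> 'e"
  assumes E: "module sE" and \<beta>: "bilinear_map sM sN sE \<beta>"
  shows "\<exists>!h. module_hom sT sE h \<and> (\<forall>a b. h (tensor a b) = \<beta> a b)"
proof -
  interpret E: module sE by fact
  let ?L = "free_lift sT (\<lambda>(a, b). tensor a b)" and ?B = "free_lift sE (\<lambda>(a, b). \<beta> a b)"
  interpret L: module_hom free_scale sT ?L by (rule T.module_hom_free_lift)
  interpret B: module_hom free_scale sE ?B by (rule E.module_hom_free_lift)
  have l: "module_hom sN sE (\<beta> a)" "module_hom sM sE (\<lambda>a. \<beta> a b)" for a b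
    using \<beta> by (auto simp: bilinear_map_def)
  have rel: "?B p = 0" if "p \<in> bilinear_relations sM sN" for p
    using that unfolding bilinear_relations_def
    by (auto simp: B.diff module_hom.add[OF l(1)] module_hom.scale[OF l(1)]
        module_hom.add[OF l(2)] module_hom.scale[OF l(2)])
  have ker: "?B p = 0" if "?L p = 0" for p
  proof -
    have "p \<in> F.span (bilinear_relations sM sN)" using that kernel by blast
    then show ?thesis
      using module_hom_free_eq_0_iff_span[OF B.module_hom_axioms rel] by blast
  qed
  have eq: "?B p = ?B q" if "?L p = ?L q" for p q
    using ker[of "p - q"] that by (simp add: L.diff B.diff)
  define h where "h v = ?B (SOME p. ?L p = v)" for v
  have hL: "h (?L p) = ?B p" for p
    unfolding h_def by (rule eq) (rule someI[of "\<lambda>q. ?L q = ?L p" p], rule refl)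
  have surj: "\<exists>p. v = ?L p" for v using onto by (metis UNIV_I imageE)
  show ?thesis
  proof (rule ex1I[of _ h], intro conjI allI)
    show "module_hom sT sE h"
    proof
      fix v w c
      obtain p q where "v = ?L p" "w = ?L q" using surj by metis
      then show "h (v + w) = h v + h w" "h (sT c v) = sE c (h v)"
        using hL B.add B.scale L.add L.scale by metis+
    qed
    show "h (tensor a b) = \<beta> a b" for a b
      using hL[of "Poly_Mapping.single (a, b) 1"] by simp
  next
    fix g assume g: "module_hom sT sE g \<and> (\<forall>a b. g (tensor a b) = \<beta> a b)"
    then interpret g: module_hom sT sE g by simp
    show "g = h"
    proof
      fix v
      obtain p where p: "v = ?L p" using surj by metis
      have "g (?L p) = ?B p"
        unfolding free_lift_def using g by (auto simp: g.sum g.scale intro!: sum.cong)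
      with p hL show "g v = h v" by simp
    qed
  qed
qed

end

text \<open>
  A tensor product with a free module always exists: finitely supported families of elements
  of the other factor.
\<close>

lemma tensor_product_free_exists:
  fixes s :: "'k::comm_ring_1 \<Rightarrow> 'd::ab_group_add \<Rightarrow> 'd"
  assumes "module s"
  shows "tensor_product s (free_scale :: 'k \<Rightarrow> ('x \<Rightarrow>\<^sub>0 'k) \<Rightarrow> _)
    (\<lambda>c. Poly_Mapping.map (s c)) (\<lambda>a. Poly_Mapping.map (\<lambda>c. s c a))"
proof -
  interpret D: module s by fact
  interpret N: module "free_scale :: 'k \<Rightarrow> ('x \<Rightarrow>\<^sub>0 'k) \<Rightarrow> _" by (rule module_free_scale)
  interpret F: module "free_scale :: 'k \<Rightarrow> ('d \<times> ('x \<Rightarrow>\<^sub>0 'k) \<Rightarrow>\<^sub>0 'k) \<Rightarrow> _" by (rule module_free_scale)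
  let ?sT = "\<lambda>c. Poly_Mapping.map (s c) :: ('x \<Rightarrow>\<^sub>0 'd) \<Rightarrow> _"
  let ?t = "\<lambda>a. Poly_Mapping.map (\<lambda>c. s c a) :: ('x \<Rightarrow>\<^sub>0 'k) \<Rightarrow> ('x \<Rightarrow>\<^sub>0 'd)"
  have lk1: "Poly_Mapping.lookup (?sT c p) z = s c (Poly_Mapping.lookup p z)" for c p z
    by (simp add: Poly_Mapping.map.rep_eq when_def)
  have lk2: "Poly_Mapping.lookup (?t a p) z = s (Poly_Mapping.lookup p z) a" for a p z
    by (simp add: Poly_Mapping.map.rep_eq when_def)
  interpret T: module ?sT
    by standard (auto intro!: poly_mapping_eqI
        simp: lk1 lookup_add D.scale_right_distrib D.scale_left_distrib)
  let ?R = "bilinear_relations s (free_scale :: 'k \<Rightarrow> ('x \<Rightarrow>\<^sub>0 'k) \<Rightarrow> _)"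
  let ?L = "free_lift ?sT (\<lambda>(a, b). ?t a b)"
  interpret L: module_hom free_scale ?sT ?L by (rule T.module_hom_free_lift)
  let ?e = "\<lambda>a b. Poly_Mapping.single (a, b) 1 :: ('d \<times> ('x \<Rightarrow>\<^sub>0 'k) \<Rightarrow>\<^sub>0 'k)"
  let ?d = "\<lambda>x. Poly_Mapping.single x 1 :: 'x \<Rightarrow>\<^sub>0 'k"
  define g where "g F = (\<Sum>x\<in>Poly_Mapping.keys F. ?e (Poly_Mapping.lookup F x) (?d x))" for F :: "'x \<Rightarrow>\<^sub>0 'd"
  define eqv where "eqv p q \<longleftrightarrow> p - q \<in> F.span ?R" for p q
  have eqv_refl: "eqv p p" for p by (simp add: eqv_def F.span_zero)
  have eqv_sym: "eqv q p" if "eqv p q" for p q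
    using F.span_neg[of "p - q" ?R] that by (simp add: eqv_def)
  have eqv_trans: "eqv p r" if "eqv p q" "eqv q r" for p q r
    using F.span_add[of "p - q" ?R "q - r"] that by (simp add: eqv_def)
  have eqv_add: "eqv (p + p') (q + q')" if "eqv p q" "eqv p' q'" for p p' q q'
    using F.span_add[of "p - q" ?R "p' - q'"] that by (simp add: eqv_def algebra_simps)
  have eqv_scale: "eqv (free_scale c p) (free_scale c q)" if "eqv p q" for c p q
    using F.span_scale[of "p - q" ?R c] that by (simp add: eqv_def F.scale_right_diff_distrib)
  have eqv_sum: "eqv (sum p A) (sum q A)" if "\<And>z. z \<in> A \<Longrightarrow> eqv (p z) (q z)" for p q and A :: "'z set"
    using that by (induction A rule: infinite_finite_induct) (auto intro: eqv_refl eqv_add)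
  have e1: "eqv (?e (a + a') b) (?e a b + ?e a' b)" for a a' b
  proof -
    have "?e (a + a') b - ?e a b - ?e a' b \<in> ?R" unfolding bilinear_relations_def by blast
    from F.span_base[OF this] show ?thesis by (simp add: eqv_def algebra_simps)
  qed
  have e2: "eqv (?e a (b + b')) (?e a b + ?e a b')" for a b b'
  proof -
    have "?e a (b + b') - ?e a b - ?e a b' \<in> ?R" unfolding bilinear_relations_def by blast
    from F.span_base[OF this] show ?thesis by (simp add: eqv_def algebra_simps)
  qed
  have e3: "eqv (?e (s c a) b) (free_scale c (?e a b))" for c a b
  proof -
    have "?e (s c a) b - Poly_Mapping.single (a, b) c \<in> ?R" unfolding bilinear_relations_def by blast
    from F.span_base[OF this] show ?thesis by (simp add: eqv_def)
  qed
  have e4: "eqv (?e a (free_scale c b)) (free_scale c (?e a b))" for c a b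
  proof -
    have "?e a (free_scale c b) - Poly_Mapping.single (a, b) c \<in> ?R" unfolding bilinear_relations_def by blast
    from F.span_base[OF this] show ?thesis by (simp add: eqv_def)
  qed
  have e01: "eqv (?e 0 b) 0" for b using e3[of 0 0 b] by simp
  have e02: "eqv (?e a 0) 0" for a using e4[of a 0 0] by simp
  have e2s: "eqv (?e a (sum f A)) (\<Sum>z\<in>A. ?e a (f z))" for a f and A :: "'x set"
  proof (induction A rule: infinite_finite_induct)
    case (insert z A)
    then show ?case using eqv_trans[OF e2 eqv_add[OF eqv_refl insert.IH]] by simp
  qed (auto simp: e02)
  have g_sup: "eqv (g F) (\<Sum>x\<in>S. ?e (Poly_Mapping.lookup F x) (?d x))"
    if "finite S" "Poly_Mapping.keys F \<subseteq> S" for F S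
  proof -
    have "g F = (\<Sum>x\<in>S. if x \<in> Poly_Mapping.keys F then ?e (Poly_Mapping.lookup F x) (?d x) else 0)"
      unfolding g_def using that
      by (intro sum.mono_neutral_cong_left) auto
    moreover have "eqv \<dots> (\<Sum>x\<in>S. ?e (Poly_Mapping.lookup F x) (?d x))"
      using eqv_sym[OF e01] by (intro eqv_sum) (auto simp: eqv_refl in_keys_iff)
    ultimately show ?thesis by simp
  qed
  have g_add: "eqv (g (F + G)) (g F + g G)" for F G
  proof -
    let ?S = "Poly_Mapping.keys F \<union> Poly_Mapping.keys G"
    have "eqv (g (F + G)) (\<Sum>x\<in>?S. ?e (Poly_Mapping.lookup (F + G) x) (?d x))"
      by (rule g_sup) (use Poly_Mapping.keys_add[of F G] in auto)
    moreover have "eqv \<dots> (\<Sum>x\<in>?S. ?e (Poly_Mapping.lookup F x) (?d x) + ?e (Poly_Mapping.lookup G x) (?d x))"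
      by (rule eqv_sum) (simp only: lookup_add e1)
    moreover have "eqv (g F + g G) \<dots>"
      unfolding sum.distrib by (intro eqv_add g_sup) auto
    ultimately show ?thesis using eqv_trans eqv_sym by blast
  qed
  have g_scale: "eqv (g (?sT c F)) (free_scale c (g F))" for c F
  proof -
    have "Poly_Mapping.keys (?sT c F) \<subseteq> Poly_Mapping.keys F"
      by (auto simp: in_keys_iff lk1)
    then have "eqv (g (?sT c F)) (\<Sum>x\<in>Poly_Mapping.keys F. ?e (Poly_Mapping.lookup (?sT c F) x) (?d x))"
      by (intro g_sup) auto
    moreover have "eqv \<dots> (\<Sum>x\<in>Poly_Mapping.keys F. free_scale c (?e (Poly_Mapping.lookup F x) (?d x)))"
      by (rule eqv_sum) (simp only: lk1 e3)
    ultimately show ?thesis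
      using eqv_trans by (simp add: g_def F.scale_sum_right)
  qed
  have gen: "eqv (?e a b) (g (?t a b))" for a b
  proof -
    have b: "(\<Sum>x\<in>Poly_Mapping.keys b. free_scale (Poly_Mapping.lookup b x) (?d x)) = b"
      using free_expand[of b] by (simp only: free_lift_def)
    have "eqv (?e a b) (\<Sum>x\<in>Poly_Mapping.keys b. ?e a (free_scale (Poly_Mapping.lookup b x) (?d x)))"
      using e2s[of a "\<lambda>x. free_scale (Poly_Mapping.lookup b x) (?d x)" "Poly_Mapping.keys b"]
      unfolding b .
    moreover have "eqv \<dots> (\<Sum>x\<in>Poly_Mapping.keys b. ?e (Poly_Mapping.lookup (?t a b) x) (?d x))"
      unfolding lk2 by (rule eqv_sum, rule eqv_trans[OF e4 eqv_sym[OF e3]])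
    moreover have "eqv (g (?t a b)) \<dots>"
      by (rule g_sup) (auto simp: in_keys_iff lk2)
    ultimately show ?thesis using eqv_trans eqv_sym by blast
  qed
  have all: "eqv p (g (?L p))" for p
  proof -
    have sub: "F.subspace {p. eqv p (g (?L p))}"
    proof (rule F.subspaceI, goal_cases)
      case 1
      show ?case by (simp add: g_def eqv_refl)
    next
      case (2 p q)
      then have "eqv (p + q) (g (?L p) + g (?L q))" by (auto intro: eqv_add)
      then show ?case using eqv_trans eqv_sym[OF g_add] by (auto simp: L.add)
    next
      case (3 c p)
      then have "eqv (free_scale c p) (free_scale c (g (?L p)))" by (auto intro: eqv_scale)
      then show ?case using eqv_trans eqv_sym[OF g_scale] by (auto simp: L.scale)
    qed
    have "Poly_Mapping.single z 1 \<in> {p. eqv p (g (?L p))}" for z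
      using gen[of "fst z" "snd z"] by (cases z) simp
    then have "(\<Sum>z\<in>Poly_Mapping.keys p. free_scale (Poly_Mapping.lookup p z) (Poly_Mapping.single z 1))
        \<in> {p. eqv p (g (?L p))}"
      by (intro F.subspace_sum[OF sub] F.subspace_scale[OF sub])
    then show ?thesis using free_expand[of p] by (simp add: free_lift_def)
  qed
  show ?thesis
  proof (intro tensor_product.intro tensor_product_axioms.intro D.module_axioms N.module_axioms
      T.module_axioms)
    show "range ?L = UNIV"
    proof (intro set_eqI iffI UNIV_I)
      fix F :: "'x \<Rightarrow>\<^sub>0 'd"
      have "F = (\<Sum>x\<in>Poly_Mapping.keys F. Poly_Mapping.single x (Poly_Mapping.lookup F x))"
        by (rule poly_mapping_eqI)
          (auto simp: lookup_sum lookup_single when_def in_keys_iff)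
      moreover have "?L (?e a (?d x)) = Poly_Mapping.single x a" for a x
        by simp
      ultimately have "F = ?L (\<Sum>x\<in>Poly_Mapping.keys F. ?e (Poly_Mapping.lookup F x) (?d x))"
        by (simp only: L.sum)
      then show "F \<in> range ?L" by blast
    qed
    have 1: "p \<in> F.span ?R" if "?L p = 0" for p
      using all[of p] that by (simp add: g_def eqv_def)
    have t: "?t (a + a') b = ?t a b + ?t a' b" "?t a (b + b') = ?t a b + ?t a b'"
      "?t (s c a) b = ?sT c (?t a b)" "?t a (free_scale c b) = ?sT c (?t a b)" for a a' b b' c
      by (rule poly_mapping_eqI, simp only: lk1 lk2 lookup_add lookup_free_scale,
          simp add: D.scale_left_distrib D.scale_right_distrib mult.commute)+
    have "?L p = 0" if "p \<in> ?R" for p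
      using that unfolding bilinear_relations_def by (auto simp: L.diff t simp del: D.scale_scale)
    then have 2: "?L p = 0" if "p \<in> F.span ?R" for p
      using that module_hom_free_eq_0_iff_span[OF L.module_hom_axioms] by blast
    show "{p. ?L p = 0} = F.span ?R" using 1 2 by blast
  qed
qed


section \<open>Graded modules\<close>

locale graded_module = module scale
  for scale :: "'k::comm_ring_1 \<Rightarrow> 'd::ab_group_add \<Rightarrow> 'd" +
  fixes G :: "int \<Rightarrow> 'd set"
  assumes subspace_G: "subspace (G i)"
    and direct_sum: "\<exists>!c. (\<forall>i. c i \<in> G i) \<and> finite {i. c i \<noteq> 0} \<and> v = (\<Sum>i | c i \<noteq> 0. c i)"

definition degree_zero_grading :: "int \<Rightarrow> 'd::zero set" where
  "degree_zero_grading i = (if i = 0 then UNIV else {0})"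

definition tensor_grading ::
  "('k::comm_ring_1 \<Rightarrow> 't::ab_group_add \<Rightarrow> 't) \<Rightarrow> ('m \<Rightarrow> 'n \<Rightarrow> 't)
    \<Rightarrow> (int \<Rightarrow> 'm set) \<Rightarrow> (int \<Rightarrow> 'n set) \<Rightarrow> int \<Rightarrow> 't set" where
  "tensor_grading sT tensor GM GN i =
    module.span sT {tensor a b | a b. \<exists>j. a \<in> GM j \<and> b \<in> GN (i - j)}"

text \<open>
  Linear maps out of a \<open>k\<close>-fold tensor power are represented by multilinear maps on lists of
  length \<open>k\<close>; values on lists of other lengths are irrelevant.
\<close>

definition multilinear ::
  "('k::comm_ring_1 \<Rightarrow> 'a::ab_group_add \<Rightarrow> 'a) \<Rightarrow> ('k \<Rightarrow> 'b::ab_group_add \<Rightarrow> 'b)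
    \<Rightarrow> nat \<Rightarrow> ('a list \<Rightarrow> 'b) \<Rightarrow> bool" where
  "multilinear sA sB k f \<longleftrightarrow>
    (\<forall>as j. length as = k \<longrightarrow> j < k \<longrightarrow> module_hom sA sB (\<lambda>v. f (as[j := v])))"

definition homogeneous :: "(int \<Rightarrow> 'a set) \<Rightarrow> 'a list \<Rightarrow> int list \<Rightarrow> bool" where
  "homogeneous G as ds \<longleftrightarrow> list_all2 (\<lambda>a d. a \<in> G d) as ds"


section \<open>Partial compositions and signs\<close>

text \<open>
  Positions are counted from 1. For \<open>as = [a\<^sub>1, \<dots>, a\<^sub>n]\<close>, \<open>seg i l as\<close> is
  \<open>[a\<^sub>i, \<dots>, a\<^bsub>i+l-1\<^esub>]\<close>, and \<open>graft i l as v\<close> is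
  \<open>[a\<^sub>1, \<dots>, a\<^bsub>i-1\<^esub>, v, a\<^bsub>i+l\<^esub>, \<dots>, a\<^sub>n]\<close>.
\<close>

definition seg :: "nat \<Rightarrow> nat \<Rightarrow> 'a list \<Rightarrow> 'a list" where
  "seg i l as = take l (drop (i - 1) as)"

definition graft :: "nat \<Rightarrow> nat \<Rightarrow> 'a list \<Rightarrow> 'a \<Rightarrow> 'a list" where
  "graft i l as v = take (i - 1) as @ [v] @ drop (i + l - 1) as"

definition stasheff_exponent :: "nat \<Rightarrow> nat \<Rightarrow> int list \<Rightarrow> int" where
  "stasheff_exponent i l ds = int i * (int l + 1) + int l * sum_list (take (i - 1) ds)"

text \<open>Degrees may be negative, so the sign \<open>(-1)\<^sup>e\<close> is determined by the parity of \<open>e\<close>.\<close>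

definition signed :: "int \<Rightarrow> 'a::ab_group_add \<Rightarrow> 'a" where
  "signed e v = (if even e then v else - v)"


section \<open>Homotopy matching dendriform algebras\<close>

text \<open>
  An element \<open>f\<close> of \<open>\<O>\<^sub>D(k)\<close> is given by the multilinear maps \<open>f\<^sup>[\<^sup>r\<^sup>]\<close>, \<open>1 \<le> r \<le> k\<close>, for the various
  \<open>x\<^sub>1, \<dots>, x\<^sub>k\<close>; here \<open>f r xs as\<close> stands for \<open>f\<^sup>[\<^sup>r\<^sup>]\<^bsub>xs\<^esub>(as)\<close>.
\<close>

definition operad_O ::
  "('k::comm_ring_1 \<Rightarrow> 'd::ab_group_add \<Rightarrow> 'd) \<Rightarrow> nat \<Rightarrow> (nat \<Rightarrow> 'x list \<Rightarrow> 'd list \<Rightarrow> 'd) set" where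
  "operad_O scale k =
    {f. \<forall>r\<in>{1..k}. \<forall>xs. length xs = k \<longrightarrow>
          multilinear scale scale k (f r xs)
        \<and> (\<forall>as y. length as = k \<longrightarrow> f r (xs[r - 1 := y]) as = f r xs as)}"

definition partial_comp ::
  "nat \<Rightarrow> (nat \<Rightarrow> 'x list \<Rightarrow> 'd list \<Rightarrow> 'd) \<Rightarrow> nat \<Rightarrow> (nat \<Rightarrow> 'x list \<Rightarrow> 'd list \<Rightarrow> 'd)
    \<Rightarrow> nat \<Rightarrow> 'x list \<Rightarrow> 'd list \<Rightarrow> 'd::comm_monoid_add" where
  "partial_comp i f l g r xs as =
    (if r < i then
       \<Sum>s = 1..l. f r (graft i l xs (xs ! (i - 1 + s - 1))) (graft i l as (g s (seg i l xs) (seg i l as)))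
     else if r < i + l then
       f i (graft i l xs (xs ! (r - 1))) (graft i l as (g (r - i + 1) (seg i l xs) (seg i l as)))
     else
       \<Sum>s = 1..l. f (r - l + 1) (graft i l xs (xs ! (i - 1 + s - 1))) (graft i l as (g s (seg i l xs) (seg i l as))))"

locale homotopy_matching_dendriform = graded_module scale G
  for scale :: "'k::comm_ring_1 \<Rightarrow> 'd::ab_group_add \<Rightarrow> 'd" and G :: "int \<Rightarrow> 'd set" +
  fixes \<pi> :: "nat \<Rightarrow> nat \<Rightarrow> 'x list \<Rightarrow> 'd list \<Rightarrow> 'd"
  assumes \<pi>_mem: "k \<ge> 1 \<Longrightarrow> \<pi> k \<in> operad_O scale k"
    and \<pi>_degree: "\<lbrakk>1 \<le> r; r \<le> k; length xs = k; length as = k; homogeneous G as ds\<rbrakk>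
      \<Longrightarrow> \<pi> k r xs as \<in> G (sum_list ds + int k - 2)"
    and \<pi>_identity: "\<lbrakk>1 \<le> r; r \<le> n; length xs = n; length as = n; homogeneous G as ds\<rbrakk>
      \<Longrightarrow> (\<Sum>k = 1..n. let l = n + 1 - k in
            \<Sum>i = 1..k. signed (stasheff_exponent i l ds) (partial_comp i (\<pi> k) l (\<pi> l) r xs as)) = 0"


section \<open>Homotopy associative algebras and bimodules\<close>

locale a_infinity_algebra = graded_module scale G
  for scale :: "'k::comm_ring_1 \<Rightarrow> 'a::ab_group_add \<Rightarrow> 'a" and G :: "int \<Rightarrow> 'a set" +
  fixes \<mu> :: "nat \<Rightarrow> 'a list \<Rightarrow> 'a"
  assumes \<mu>_multilinear: "k \<ge> 1 \<Longrightarrow> multilinear scale scale k (\<mu> k)"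
    and \<mu>_degree: "\<lbrakk>k \<ge> 1; length as = k; homogeneous G as ds\<rbrakk>
      \<Longrightarrow> \<mu> k as \<in> G (sum_list ds + int k - 2)"
    and \<mu>_identity: "\<lbrakk>n \<ge> 1; length as = n; homogeneous G as ds\<rbrakk>
      \<Longrightarrow> (\<Sum>k = 1..n. let l = n + 1 - k in
            \<Sum>i = 1..k. signed (stasheff_exponent i l ds)
              (\<mu> k (graft i l as (\<mu> l (seg i l as))))) = 0"

text \<open>
  Tuples with all but one entry in \<open>A\<close> and one entry in \<open>M\<close> are lists over \<open>A + M\<close> with
  exactly one entry of the form \<open>Inr u\<close>. A linear map on \<open>\<A>\<^bsup>k-1,1\<^esup>\<close> is a map on such lists
  that is linear in every entry.
\<close>

definition mixed :: "nat \<Rightarrow> ('a + 'm) list \<Rightarrow> bool" where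
  "mixed k zs \<longleftrightarrow> length zs = k \<and> (\<exists>!j. j < k \<and> \<not> isl (zs ! j))"

definition mixed_multilinear ::
  "('k::comm_ring_1 \<Rightarrow> 'a::ab_group_add \<Rightarrow> 'a) \<Rightarrow> ('k \<Rightarrow> 'm::ab_group_add \<Rightarrow> 'm)
    \<Rightarrow> nat \<Rightarrow> (('a + 'm) list \<Rightarrow> 'm) \<Rightarrow> bool" where
  "mixed_multilinear sA sM k f \<longleftrightarrow>
    (\<forall>zs j. mixed k zs \<longrightarrow> j < k \<longrightarrow>
      (if isl (zs ! j) then module_hom sA sM (\<lambda>a. f (zs[j := Inl a]))
       else module_hom sM sM (\<lambda>u. f (zs[j := Inr u]))))"

definition sum_grading :: "(int \<Rightarrow> 'a set) \<Rightarrow> (int \<Rightarrow> 'm set) \<Rightarrow> int \<Rightarrow> ('a + 'm) set" where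
  "sum_grading GA GM d = GA d <+> GM d"

definition mixed_op ::
  "(nat \<Rightarrow> 'a list \<Rightarrow> 'a) \<Rightarrow> (nat \<Rightarrow> ('a + 'm) list \<Rightarrow> 'm) \<Rightarrow> nat \<Rightarrow> ('a + 'm) list \<Rightarrow> 'a + 'm" where
  "mixed_op \<mu> \<eta> k zs =
    (if \<forall>z\<in>set zs. isl z then Inl (\<mu> k (map projl zs)) else Inr (\<eta> k zs))"

locale a_infinity_bimodule =
  A: a_infinity_algebra sA GA \<mu> + M: graded_module sM GM
  for sA :: "'k::comm_ring_1 \<Rightarrow> 'a::ab_group_add \<Rightarrow> 'a" and GA :: "int \<Rightarrow> 'a set"
    and \<mu> :: "nat \<Rightarrow> 'a list \<Rightarrow> 'a"
    and sM :: "'k \<Rightarrow> 'm::ab_group_add \<Rightarrow> 'm" and GM :: "int \<Rightarrow> 'm set" +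
  fixes \<eta> :: "nat \<Rightarrow> ('a + 'm) list \<Rightarrow> 'm"
  assumes \<eta>_multilinear: "k \<ge> 1 \<Longrightarrow> mixed_multilinear sA sM k (\<eta> k)"
    and \<eta>_degree: "\<lbrakk>k \<ge> 1; mixed k zs; homogeneous (sum_grading GA GM) zs ds\<rbrakk>
      \<Longrightarrow> \<eta> k zs \<in> GM (sum_list ds + int k - 2)"
    and \<eta>_identity: "\<lbrakk>n \<ge> 1; mixed n zs; homogeneous (sum_grading GA GM) zs ds\<rbrakk>
      \<Longrightarrow> (\<Sum>k = 1..n. let l = n + 1 - k in
            \<Sum>i = 1..k. signed (stasheff_exponent i l ds)
              (\<eta> k (graft i l zs (mixed_op \<mu> \<eta> l (seg i l zs))))) = 0"


section \<open>Homotopy matching relative Rota-Baxter algebras\<close>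

text \<open>\<open>rb_args P r xs us\<close> is \<open>(P\<^bsub>x1\<^esub>(u\<^sub>1), \<dots>, u\<^sub>r, \<dots>, P\<^bsub>xk\<^esub>(u\<^sub>k))\<close>, with \<open>u\<^sub>r\<close> at position \<open>r\<close>.\<close>

definition rb_args :: "('x \<Rightarrow> 'm \<Rightarrow> 'a) \<Rightarrow> nat \<Rightarrow> 'x list \<Rightarrow> 'm list \<Rightarrow> ('a + 'm) list" where
  "rb_args P r xs us = (map2 (\<lambda>x u. Inl (P x u)) xs us)[r - 1 := Inr (us ! (r - 1))]"

locale homotopy_matching_relative_rota_baxter =
  a_infinity_bimodule sA GA \<mu> sM GM \<eta>
  for sA :: "'k::comm_ring_1 \<Rightarrow> 'a::ab_group_add \<Rightarrow> 'a" and GA :: "int \<Rightarrow> 'a set"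
    and \<mu> :: "nat \<Rightarrow> 'a list \<Rightarrow> 'a"
    and sM :: "'k \<Rightarrow> 'm::ab_group_add \<Rightarrow> 'm" and GM :: "int \<Rightarrow> 'm set"
    and \<eta> :: "nat \<Rightarrow> ('a + 'm) list \<Rightarrow> 'm" +
  fixes P :: "'x \<Rightarrow> 'm \<Rightarrow> 'a"
  assumes P_linear: "module_hom sM sA (P x)"
    and P_degree: "u \<in> GM i \<Longrightarrow> P x u \<in> GA i"
    and P_identity: "\<lbrakk>k \<ge> 1; length xs = k; length us = k\<rbrakk>
      \<Longrightarrow> \<mu> k (map2 P xs us) = (\<Sum>r = 1..k. P (xs ! (r - 1)) (\<eta> k (rb_args P r xs us)))"

definition induced_dendriform ::
  "(nat \<Rightarrow> ('a + 'm) list \<Rightarrow> 'm) \<Rightarrow> ('x \<Rightarrow> 'm \<Rightarrow> 'a) \<Rightarrow> nat \<Rightarrow> nat \<Rightarrow> 'x list \<Rightarrow> 'm list \<Rightarrow> 'm" where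
  "induced_dendriform \<eta> P k r xs us = \<eta> k (rb_args P r xs us)"


section \<open>The structure maps on the tensor product with the free module\<close>

definition total_products ::
  "('k::comm_ring_1 \<Rightarrow> 't::ab_group_add \<Rightarrow> 't) \<Rightarrow> ('d \<Rightarrow> ('x \<Rightarrow>\<^sub>0 'k) \<Rightarrow> 't)
    \<Rightarrow> (nat \<Rightarrow> nat \<Rightarrow> 'x list \<Rightarrow> 'd list \<Rightarrow> 'd) \<Rightarrow> (nat \<Rightarrow> 't list \<Rightarrow> 't) \<Rightarrow> bool" where
  "total_products sT tensor \<pi> \<mu> \<longleftrightarrow>
    (\<forall>k\<ge>1. multilinear sT sT k (\<mu> k) \<and>
      (\<forall>as xs. length as = k \<longrightarrow> length xs = k \<longrightarrow>
        \<mu> k (map2 (\<lambda>a x. tensor a (Poly_Mapping.single x 1)) as xs)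
        = (\<Sum>r = 1..k. tensor (\<pi> k r xs as) (Poly_Mapping.single (xs ! (r - 1)) 1))))"

definition total_actions ::
  "('k::comm_ring_1 \<Rightarrow> 't::ab_group_add \<Rightarrow> 't) \<Rightarrow> ('k \<Rightarrow> 'd::ab_group_add \<Rightarrow> 'd)
    \<Rightarrow> ('d \<Rightarrow> ('x \<Rightarrow>\<^sub>0 'k) \<Rightarrow> 't)
    \<Rightarrow> (nat \<Rightarrow> nat \<Rightarrow> 'x list \<Rightarrow> 'd list \<Rightarrow> 'd) \<Rightarrow> (nat \<Rightarrow> ('t + 'd) list \<Rightarrow> 'd) \<Rightarrow> bool" where
  "total_actions sT sD tensor \<pi> \<eta> \<longleftrightarrow>
    (\<forall>k\<ge>1. mixed_multilinear sT sD k (\<eta> k) \<and>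
      (\<forall>as xs. \<forall>r\<in>{1..k}. length as = k \<longrightarrow> length xs = k \<longrightarrow>
        \<eta> k ((map2 (\<lambda>a x. Inl (tensor a (Poly_Mapping.single x 1))) as xs)[r - 1 := Inr (as ! (r - 1))])
        = \<pi> k r xs as))"

end

theory Submission
  imports Defs
begin

text \<open>
  Since \<open>\<K>[X]\<close> is free, every element of \<open>D \<otimes> \<K>[X]\<close> is a finite sum of elements
  \<open>pure x a = a \<otimes> x\<close>, and the coefficients \<open>coord x v\<close> are unique. Two things follow. Operations prescribed on the elements \<open>a \<otimes> x\<close> extend multilinearly by
  summing over the supports of the arguments (\<open>extend_multilinear\<close>, \<open>extend_pure\<close>), and the
  degree \<open>i\<close> part of \<open>D \<otimes> \<K>[X]\<close> consists of the elements all of whose coordinates have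
  degree \<open>i\<close>, so that the grading of \<open>D\<close> is inherited coordinatewise (\<open>graded_module_tensor\<close>).

  The identities then hold because, on the elements \<open>a \<otimes> x\<close>, the composition
  \<open>\<mu>\<^sub>k(\<dots>, \<mu>\<^sub>l(\<dots>), \<dots>)\<close> is \<open>\<Sum>\<^sub>r (\<pi>\<^sub>k \<circ>\<^sub>i \<pi>\<^sub>l)\<^sup>[\<^sup>r\<^sup>](\<dots>) \<otimes> x\<^sub>r\<close>, and \<open>\<eta>\<^sub>k(\<dots>, \<eta>\<^sub>l or \<mu>\<^sub>l, \<dots>)\<close> with its
  module entry at position \<open>r\<close> is \<open>(\<pi>\<^sub>k \<circ>\<^sub>i \<pi>\<^sub>l)\<^sup>[\<^sup>r\<^sup>](\<dots>)\<close>; this is what the three cases in the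
  partial composition are made for (\<open>product_composition\<close>, \<open>action_composition\<close>). In the
  first formula the sum over \<open>s\<close> produced by \<open>\<mu>\<^sub>l\<close> and the sum over the positions of the outer operation
  are regrouped by the letter \<open>x\<^sub>r\<close> that the resulting summand carries: positions outside the
  grafted block collect the whole sum over \<open>s\<close>, while the grafting position itself carries
  the letter of \<open>s\<close> and therefore spreads over the block. With the signs attached, each
  coefficient vanishes by the dendriform identity for that \<open>r\<close>. The passage from homogeneous
  \<open>a \<otimes> x\<close> to arbitrary homogeneous arguments is by multilinearity, one entry at a time
  (\<open>entrywise_reduction\<close>): the signs depend only on the degrees, which stay fixed.

  Finally \<open>\<eta>\<^sub>k(P\<^bsub>x1\<^esub>(u\<^sub>1), \<dots>, u\<^sub>r, \<dots>, P\<^bsub>xk\<^esub>(u\<^sub>k)) = (\<pi>\<^sub>k)\<^sup>[\<^sup>r\<^sup>]\<close> for \<open>P\<^sub>x = pure x\<close> by the formula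
  that determines \<open>\<eta>\<close>, which gives the Rota-Baxter identity and the last claim.
\<close>

section \<open>Module homomorphisms and reduction to generators\<close>

lemma module_hom_signed:
  assumes "module_hom s1 s2 f"
  shows "module_hom s1 s2 (\<lambda>x. signed e (f x))"
  using assms by (auto simp: signed_def module_hom_iff module.scale_minus_right)

text \<open>
  Both modules are assumed outright, so that no case distinction on an empty index set arises.
\<close>

lemma module_hom_sum':
  assumes "module s1" "module s2" "\<And>i. i \<in> I \<Longrightarrow> module_hom s1 s2 (f i)"
  shows "module_hom s1 s2 (\<lambda>x. \<Sum>i\<in>I. f i x)"
proof -
  interpret module_pair s1 s2 using assms by (simp add: module_pair_def)
  show ?thesis using assms by (intro module_hom_sum) auto
qed

lemma signed_sum: "signed e (\<Sum>i\<in>I. f i) = (\<Sum>i\<in>I. signed e (f i))"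
  by (simp add: signed_def sum_negf)

lemma module_hom_span_into_subspace:
  assumes "module_hom s1 s2 h" "module.subspace s2 W"
    and "\<And>z. z \<in> R \<Longrightarrow> h z \<in> W" "v \<in> module.span s1 R"
  shows "h v \<in> W"
proof -
  interpret h: module_hom s1 s2 h by fact
  have "h.m1.span R \<subseteq> {x. h x \<in> W}"
    using assms by (intro h.m1.span_minimal h.subspace_linear_preimage) auto
  with assms(4) show ?thesis by auto
qed

text \<open>
  Properties of lists whose entries satisfy \<open>R\<close> need only be shown for entries that satisfy the
  stronger \<open>S\<close>, if any single entry can be exchanged. In the applications \<open>R j\<close> is either \<open>S j\<close>
  itself or the span of the generators \<open>S j\<close>, and \<open>step\<close> is linearity in entry \<open>j\<close>. The induction is on the length of the
  initial part whose entries are not yet generators; the last of them is exchanged first.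
\<close>

lemma entrywise_reduction:
  assumes step: "\<And>zs j. length zs = n \<Longrightarrow> j < n \<Longrightarrow> \<forall>i<n. R i (zs ! i)
      \<Longrightarrow> (\<And>z. S j z \<Longrightarrow> Q (zs[j := z])) \<Longrightarrow> Q zs"
    and SR: "\<And>j z. j < n \<Longrightarrow> S j z \<Longrightarrow> R j z"
    and base: "\<And>zs. length zs = n \<Longrightarrow> \<forall>i<n. S i (zs ! i) \<Longrightarrow> Q zs"
    and zs: "length zs = n" "\<forall>i<n. R i (zs ! i)"
  shows "Q zs"
proof -
  have "Q zs" if "m \<le> n" "length zs = n" "\<forall>i<m. R i (zs ! i)" "\<forall>i. m \<le> i \<longrightarrow> i < n \<longrightarrow> S i (zs ! i)"
    for m zs
    using that
  proof (induction m arbitrary: zs)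
    case 0
    then show ?case by (intro base) auto
  next
    case (Suc m)
    show ?case
    proof (rule step[of _ m])
      show "\<forall>i<n. R i (zs ! i)"
        using Suc.prems SR by (metis less_le_not_le not_less)
      fix z assume "S m z"
      then show "Q (zs[m := z])"
        using Suc.prems by (intro Suc.IH) (auto simp: nth_list_update le_Suc_eq less_Suc_eq Suc_le_eq)
    qed (use Suc.prems in auto)
  qed
  from this[of n zs] zs show ?thesis by auto
qed

lemma multilinearD:
  "multilinear sA sB k f \<Longrightarrow> length as = k \<Longrightarrow> j < k \<Longrightarrow> module_hom sA sB (\<lambda>v. f (as[j := v]))"
  by (simp add: multilinear_def)

lemma multilinear_zero_entry:
  assumes "multilinear sA sB k f" "length as = k" "j < k" "as ! j = 0"
  shows "f as = 0"
proof -
  interpret module_hom sA sB "\<lambda>v. f (as[j := v])" using assms(1-3) by (rule multilinearD)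
  show ?thesis using zero assms(4) by (metis list_update_id)
qed


section \<open>Coordinates on the tensor product with a free module\<close>

locale free_tensor_product =
  tensor_product sD "free_scale :: 'k \<Rightarrow> ('x \<Rightarrow>\<^sub>0 'k) \<Rightarrow> ('x \<Rightarrow>\<^sub>0 'k)" sT tensor
  for sD :: "'k::comm_ring_1 \<Rightarrow> 'd::ab_group_add \<Rightarrow> 'd"
    and sT :: "'k \<Rightarrow> 't::ab_group_add \<Rightarrow> 't"
    and tensor :: "'d \<Rightarrow> ('x \<Rightarrow>\<^sub>0 'k) \<Rightarrow> 't"
begin

abbreviation pure :: "'x \<Rightarrow> 'd \<Rightarrow> 't" where
  "pure x a \<equiv> tensor a (Poly_Mapping.single x 1)"

text \<open>
  The map \<open>id \<otimes> ev\<^sub>x\<close>, where \<open>ev\<^sub>x\<close> reads off the coefficient of the basis element \<open>x\<close>; the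
  description is unique by the universal property.
\<close>

definition coord :: "'x \<Rightarrow> 't \<Rightarrow> 'd" where
  "coord x = (THE h. module_hom sT sD h \<and> (\<forall>a p. h (tensor a p) = sD (Poly_Mapping.lookup p x) a))"

lemma coord_characterization:
  "module_hom sT sD (coord x) \<and> (\<forall>a p. coord x (tensor a p) = sD (Poly_Mapping.lookup p x) a)"
proof -
  have "bilinear_map sD free_scale sD (\<lambda>a p. sD (Poly_Mapping.lookup p x) a)"
    unfolding bilinear_map_def module_hom_iff
    by (auto simp: M.module_axioms N.module_axioms M.scale_left_distrib M.scale_right_distrib
        lookup_add mult.commute)
  from theI'[OF universal_property[OF M.module_axioms this]]
  show ?thesis unfolding coord_def .
qed

lemma module_hom_coord: "module_hom sT sD (coord x)"
  and coord_tensor: "coord x (tensor a p) = sD (Poly_Mapping.lookup p x) a"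
  using coord_characterization by blast+

sublocale coord: module_hom sT sD "coord x" for x
  by (rule module_hom_coord)

lemma coord_pure: "coord x (pure y a) = (if x = y then a else 0)"
  by (simp add: coord_tensor lookup_single when_def)

lemma module_hom_pure: "module_hom sD sT (pure x)"
  using bilinear unfolding bilinear_map_def by blast

sublocale pure: module_hom sD sT "pure x" for x
  by (rule module_hom_pure)

lemma tensor_eq_sum_pure:
  assumes "finite S" "Poly_Mapping.keys p \<subseteq> S"
  shows "tensor a p = (\<Sum>x\<in>S. pure x (coord x (tensor a p)))"
proof -
  interpret r: module_hom free_scale sT "tensor a"
    using bilinear unfolding bilinear_map_def by blast
  have "p = (\<Sum>x\<in>S. free_scale (Poly_Mapping.lookup p x) (Poly_Mapping.single x 1))"
    using free_expand[of p] N.free_lift_superset[OF assms] by simp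
  then have "tensor a p = (\<Sum>x\<in>S. tensor a (free_scale (Poly_Mapping.lookup p x) (Poly_Mapping.single x 1)))"
    by (metis r.sum)
  also have "\<dots> = (\<Sum>x\<in>S. pure x (coord x (tensor a p)))"
    by (rule sum.cong) (simp_all only: r.scale pure.scale coord_tensor)
  finally show ?thesis .
qed

text \<open>
  Quantifying over all larger finite sets \<open>S'\<close> makes the property visibly stable under sums
  and multiples: two elements can be expanded over a common index set. As it holds for the elements \<open>tensor a b\<close>,
  it holds everywhere, because these generate.
\<close>

lemma finite_expansion:
  "\<exists>S. finite S \<and> (\<forall>S'. finite S' \<longrightarrow> S \<subseteq> S' \<longrightarrow> v = (\<Sum>x\<in>S'. pure x (coord x v)))"
  (is "?P v")
proof -
  have "T.subspace {v. ?P v}"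
  proof (rule T.subspaceI, goal_cases)
    case 1
    show ?case by auto
  next
    case (2 v w)
    then obtain S S' where S: "finite S" "finite S'"
      and v: "\<And>U. finite U \<Longrightarrow> S \<subseteq> U \<Longrightarrow> v = (\<Sum>x\<in>U. pure x (coord x v))"
      and w: "\<And>U. finite U \<Longrightarrow> S' \<subseteq> U \<Longrightarrow> w = (\<Sum>x\<in>U. pure x (coord x w))"
      by blast
    have "v + w = (\<Sum>x\<in>U. pure x (coord x (v + w)))" if "finite U" "S \<union> S' \<subseteq> U" for U
    proof -
      have "v + w = (\<Sum>x\<in>U. pure x (coord x v)) + (\<Sum>x\<in>U. pure x (coord x w))"
        using that by (intro arg_cong2[where f = "(+)", OF v w]) auto
      also have "\<dots> = (\<Sum>x\<in>U. pure x (coord x (v + w)))"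
        by (simp only: coord.add pure.add sum.distrib)
      finally show ?thesis .
    qed
    with S show ?case by blast
  next
    case (3 c v)
    then obtain S where S: "finite S"
      and v: "\<And>U. finite U \<Longrightarrow> S \<subseteq> U \<Longrightarrow> v = (\<Sum>x\<in>U. pure x (coord x v))"
      by blast
    have "sT c v = (\<Sum>x\<in>U. pure x (coord x (sT c v)))" if "finite U" "S \<subseteq> U" for U
    proof -
      have "sT c v = sT c (\<Sum>x\<in>U. pure x (coord x v))"
        using that by (intro arg_cong[where f = "sT c", OF v])
      also have "\<dots> = (\<Sum>x\<in>U. pure x (coord x (sT c v)))"
        by (simp only: coord.scale pure.scale T.scale_sum_right)
      finally show ?thesis .
    qed
    with S show ?case by blast
  qed
  moreover have "tensor a b \<in> {v. ?P v}" for a b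
    using tensor_eq_sum_pure[of _ b a] by (blast intro: exI[of _ "Poly_Mapping.keys b"] finite_keys)
  ultimately have *: "free_lift sT (\<lambda>(a, b). tensor a b) p \<in> {v. ?P v}" for p
    unfolding free_lift_def split_beta by (intro T.subspace_sum T.subspace_scale)
  have "v \<in> range (free_lift sT (\<lambda>(a, b). tensor a b))" using onto by simp
  then show ?thesis using * by blast
qed

definition supp :: "'t \<Rightarrow> 'x set" where
  "supp v = {x. coord x v \<noteq> 0}"

lemma coord_sum_pure:
  "finite S \<Longrightarrow> coord y (\<Sum>x\<in>S. pure x (f x)) = (if y \<in> S then f y else 0)"
  by (simp add: coord.sum coord_pure)

lemma finite_supp: "finite (supp v)"
proof -
  obtain S where "finite S" "v = (\<Sum>x\<in>S. pure x (coord x v))"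
    using finite_expansion[of v] by blast
  then have "coord y v = 0" if "y \<notin> S" for y
    using coord_sum_pure[of S y "\<lambda>x. coord x v"] that by (metis (no_types, lifting))
  then have "supp v \<subseteq> S" unfolding supp_def by blast
  then show ?thesis using \<open>finite S\<close> finite_subset by blast
qed

text \<open>
  Since \<open>supp v\<close> is not additive in \<open>v\<close>, linearity of sums over the support is proved after
  enlarging the index set to one that serves both summands.
\<close>

lemma sum_over_supp:
  assumes "finite S" "supp v \<subseteq> S" "\<And>x. h x 0 = 0"
  shows "(\<Sum>x\<in>supp v. h x (coord x v)) = (\<Sum>x\<in>S. h x (coord x v))"
  using assms by (intro sum.mono_neutral_left) (auto simp: supp_def)

lemma pure_expansion: "v = (\<Sum>x\<in>supp v. pure x (coord x v))"
proof -
  obtain S where S: "finite S" "\<And>S'. finite S' \<Longrightarrow> S \<subseteq> S' \<Longrightarrow> v = (\<Sum>x\<in>S'. pure x (coord x v))"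
    using finite_expansion[of v] by blast
  have "(\<Sum>x\<in>supp v. pure x (coord x v)) = (\<Sum>x\<in>S \<union> supp v. pure x (coord x v))"
    using S(1) finite_supp by (intro sum_over_supp) auto
  with S(2)[of "S \<union> supp v"] S(1) finite_supp show ?thesis by simp
qed

lemma coord_eqI: "(\<And>x. coord x v = coord x w) \<Longrightarrow> v = w"
proof -
  assume eq: "\<And>x. coord x v = coord x w"
  have "v = (\<Sum>x\<in>supp v. pure x (coord x v))" by (rule pure_expansion)
  also have "\<dots> = (\<Sum>x\<in>supp w. pure x (coord x w))" by (simp only: supp_def eq)
  also have "\<dots> = w" by (rule pure_expansion[symmetric])
  finally show "v = w" .
qed

lemma module_hom_sum_over_supp:
  assumes "module sE" "\<And>x. module_hom sD sE (h x)"
  shows "module_hom sT sE (\<lambda>v. \<Sum>x\<in>supp v. h x (coord x v))"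
proof -
  interpret E: module sE by fact
  interpret h: module_hom sD sE "h x" for x by fact
  show ?thesis
  proof
    fix v w c
    let ?S = "supp v \<union> supp w"
    have "supp (v + w) \<subseteq> ?S" by (auto simp: supp_def coord.add)
    then have "(\<Sum>x\<in>supp (v + w). h x (coord x (v + w))) = (\<Sum>x\<in>?S. h x (coord x (v + w)))"
      by (intro sum_over_supp) (simp_all add: finite_supp h.zero)
    also have "\<dots> = (\<Sum>x\<in>?S. h x (coord x v)) + (\<Sum>x\<in>?S. h x (coord x w))"
      by (simp only: coord.add h.add sum.distrib)
    finally show "(\<Sum>x\<in>supp (v + w). h x (coord x (v + w)))
        = (\<Sum>x\<in>supp v. h x (coord x v)) + (\<Sum>x\<in>supp w. h x (coord x w))"
      by (simp add: sum_over_supp[of ?S] finite_supp h.zero)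
    have "supp (sT c v) \<subseteq> supp v" by (auto simp: supp_def coord.scale)
    then have "(\<Sum>x\<in>supp (sT c v). h x (coord x (sT c v))) = (\<Sum>x\<in>supp v. h x (coord x (sT c v)))"
      by (intro sum_over_supp) (simp_all add: finite_supp h.zero)
    then show "(\<Sum>x\<in>supp (sT c v). h x (coord x (sT c v))) = sE c (\<Sum>x\<in>supp v. h x (coord x v))"
      by (simp only: h.scale coord.scale E.scale_sum_right)
  qed
qed

lemma sum_over_supp_pure:
  assumes "\<And>x. h x 0 = 0"
  shows "(\<Sum>x\<in>supp (pure y a). h x (coord x (pure y a))) = h y a"
proof -
  have "supp (pure y a) = (if a = 0 then {} else {y})" by (auto simp: supp_def coord_pure)
  then show ?thesis by (simp add: coord_pure assms)
qed


section \<open>The grading of the tensor product\<close>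

context
  fixes G :: "int \<Rightarrow> 'd set"
  assumes graded: "graded_module sD G"
begin

interpretation D: graded_module sD G by (rule graded)

text \<open>
  The second factor is concentrated in degree 0, so a generator \<open>tensor a b\<close> of degree \<open>i\<close> either
  has \<open>a\<close> of degree \<open>i\<close> or has \<open>b = 0\<close>.
\<close>

lemma tensor_grading_eq_span_pure:
  "tensor_grading sT tensor G degree_zero_grading i = T.span {pure x a |x a. a \<in> G i}"
proof -
  let ?A = "{tensor a b |a b. \<exists>j. a \<in> G j \<and> b \<in> degree_zero_grading (i - j)}"
  let ?B = "{pure x a |x a. a \<in> G i}"
  have 0: "tensor a 0 = 0" for a
    using bilinear module_hom.zero unfolding module_hom_iff bilinear_map_def
    by (metis N.scale_zero_left T.scale_zero_left)
  have "tensor a b \<in> T.span ?B" if "a \<in> G j" "b \<in> degree_zero_grading (i - j)" for a b j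
  proof (cases "i = j")
    case True
    have "coord x (tensor a b) \<in> G i" for x
      using that True D.subspace_G by (auto simp: coord_tensor M.subspace_scale)
    then have "(\<Sum>x\<in>Poly_Mapping.keys b. pure x (coord x (tensor a b))) \<in> T.span ?B"
      by (intro T.span_sum T.span_base) auto
    then show ?thesis using tensor_eq_sum_pure[of "Poly_Mapping.keys b" b a] by simp
  next
    case False
    then have "b = 0" using that by (simp add: degree_zero_grading_def)
    then show ?thesis by (simp add: 0 T.span_zero)
  qed
  then have "T.span ?A \<subseteq> T.span ?B"
    by (intro T.span_minimal) auto
  moreover have "?B \<subseteq> ?A" by (force simp: degree_zero_grading_def)
  then have "T.span ?B \<subseteq> T.span ?A" by (rule T.span_mono)
  ultimately show ?thesis unfolding tensor_grading_def by (rule equalityI)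
qed

lemma tensor_grading_iff_coord:
  "v \<in> tensor_grading sT tensor G degree_zero_grading i \<longleftrightarrow> (\<forall>x. coord x v \<in> G i)"
proof
  assume "v \<in> tensor_grading sT tensor G degree_zero_grading i"
  then have v: "v \<in> T.span {pure x a |x a. a \<in> G i}" by (simp add: tensor_grading_eq_span_pure)
  show "\<forall>x. coord x v \<in> G i"
  proof
    fix x
    show "coord x v \<in> G i"
      using D.subspace_G M.subspace_0[OF D.subspace_G]
      by (intro module_hom_span_into_subspace[OF module_hom_coord _ _ v]) (auto simp: coord_pure)
  qed
next
  assume "\<forall>x. coord x v \<in> G i"
  then have "(\<Sum>x\<in>supp v. pure x (coord x v)) \<in> T.span {pure x a |x a. a \<in> G i}"
    by (intro T.span_sum T.span_base) auto
  then show "v \<in> tensor_grading sT tensor G degree_zero_grading i"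
    using pure_expansion[of v] by (simp add: tensor_grading_eq_span_pure)
qed

text \<open>
  Homogeneous decompositions correspond to homogeneous decompositions of all coordinates. The
  degrees that occur form a finite set because only finitely many coordinates are nonzero.
\<close>

lemma graded_module_tensor:
  "graded_module sT (tensor_grading sT tensor G degree_zero_grading)" (is "graded_module sT ?T")
proof
  show "T.subspace (?T i)" for i by (simp add: tensor_grading_def)
next
  fix v
  let ?dec = "\<lambda>G v c. (\<forall>i. c i \<in> G i) \<and> finite {i. c i \<noteq> 0} \<and> v = (\<Sum>i | c i \<noteq> 0. c i)"
  have "\<forall>x. \<exists>c. ?dec G (coord x v) c" using D.direct_sum by blast
  then obtain d where d: "\<And>x. ?dec G (coord x v) (d x)" by metis
  let ?I = "\<Union>x\<in>supp v. {i. d x i \<noteq> 0}"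
  define e where "e i = (\<Sum>x\<in>supp v. pure x (d x i))" for i
  have I: "finite ?I" using d finite_supp by blast
  have "e i \<in> ?T i" for i
    unfolding e_def tensor_grading_eq_span_pure using d by (intro T.span_sum T.span_base) blast
  moreover have sub: "{i. e i \<noteq> 0} \<subseteq> ?I"
  proof
    fix i assume "i \<in> {i. e i \<noteq> 0}"
    then obtain x where "x \<in> supp v" "pure x (d x i) \<noteq> 0"
      unfolding e_def using sum.not_neutral_contains_not_neutral by blast
    moreover from this have "d x i \<noteq> 0" using pure.zero[of x] by (intro notI) simp
    ultimately show "i \<in> ?I" by blast
  qed
  moreover have "v = (\<Sum>i | e i \<noteq> 0. e i)"
  proof -
    have "v = (\<Sum>x\<in>supp v. pure x (\<Sum>i\<in>?I. d x i))"
    proof (subst pure_expansion, rule sum.cong)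
      fix x assume "x \<in> supp v"
      then have "(\<Sum>i | d x i \<noteq> 0. d x i) = (\<Sum>i\<in>?I. d x i)"
        using I by (intro sum.mono_neutral_left) auto
      with d[of x] show "pure x (coord x v) = pure x (\<Sum>i\<in>?I. d x i)" by simp
    qed simp
    also have "\<dots> = (\<Sum>i\<in>?I. e i)"
      unfolding e_def pure.sum by (rule sum.swap)
    also have "\<dots> = (\<Sum>i | e i \<noteq> 0. e i)"
      using I sub by (intro sum.mono_neutral_right) auto
    finally show ?thesis .
  qed
  ultimately have "?dec ?T v e" using finite_subset[OF sub I] by blast
  moreover have "c = c'" if "?dec ?T v c" "?dec ?T v c'" for c c'
  proof -
    have *: "?dec G (coord x v) (\<lambda>i. coord x (f i))" if "?dec ?T v f" for f x
    proof (intro conjI allI)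
      show "coord x (f i) \<in> G i" for i using that tensor_grading_iff_coord by blast
      have sub: "{i. coord x (f i) \<noteq> 0} \<subseteq> {i. f i \<noteq> 0}" by auto
      with that show "finite {i. coord x (f i) \<noteq> 0}" using finite_subset by blast
      have "coord x v = (\<Sum>i | f i \<noteq> 0. coord x (f i))" using that by (metis coord.sum)
      also have "\<dots> = (\<Sum>i | coord x (f i) \<noteq> 0. coord x (f i))"
        using sub that by (intro sum.mono_neutral_right) auto
      finally show "coord x v = \<dots>" .
    qed
    have "(\<lambda>i. coord x (c i)) = (\<lambda>i. coord x (c' i))" for x
    proof -
      have u: "\<exists>!f. ?dec G (coord x v) f" by (rule D.direct_sum)
      show ?thesis
        using the1_equality[OF u, OF *[OF that(1)]] the1_equality[OF u, OF *[OF that(2)]]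
        by (rule trans[OF sym])
    qed
    then have "coord x (c i) = coord x (c' i)" for x i by (rule fun_cong)
    then show ?thesis by (intro ext coord_eqI)
  qed
  ultimately show "\<exists>!c. ?dec ?T v c" by (intro ex1I)
qed

end


section \<open>Multilinear extension from pure tensors\<close>

text \<open>
  The sum of \<open>F xs [coord x\<^sub>1 v\<^sub>1, \<dots>, coord x\<^sub>k v\<^sub>k]\<close> over all words \<open>xs = [x\<^sub>1, \<dots>, x\<^sub>k]\<close> with
  \<open>x\<^sub>j \<in> supp v\<^sub>j\<close>. Summing one letter at a time lets linearity in one entry be proved by induction on the
  list, without a common index set of words.
\<close>

primrec extend :: "'t list \<Rightarrow> ('x list \<Rightarrow> 'd list \<Rightarrow> 'e::comm_monoid_add) \<Rightarrow> 'e" where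
  "extend [] F = F [] []"
| "extend (v # vs) F = (\<Sum>x\<in>supp v. extend vs (\<lambda>xs as. F (x # xs) (coord x v # as)))"

lemma module_hom_extend_family:
  assumes "module sE" "\<And>xs as. length xs = length vs \<Longrightarrow> length as = length vs \<Longrightarrow> module_hom sD sE (\<lambda>a. H a xs as)"
  shows "module_hom sD sE (\<lambda>a. extend vs (H a))"
  using assms
proof (induction vs arbitrary: H)
  case (Cons v vs)
  then show ?case by (auto intro!: module_hom_sum' M.module_axioms)
qed simp

lemma extend_multilinear:
  assumes E: "module sE" and F: "\<And>xs. length xs = k \<Longrightarrow> multilinear sD sE k (F xs)"
  shows "multilinear sT sE k (\<lambda>vs. extend vs F)"
proof -
  have "module_hom sT sE (\<lambda>v. extend (vs[j := v]) F)"
    if "\<And>xs. length xs = length vs \<Longrightarrow> multilinear sD sE (length vs) (F xs)" "j < length vs" for vs j F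
    using that
  proof (induction vs arbitrary: j F)
    case (Cons w vs)
    show ?case
    proof (cases j)
      case 0
      \<comment> \<open>The head occurs only through its coordinates, so linearity in each \<open>coord x v\<close> suffices.\<close>
      have "module_hom sD sE (\<lambda>a. extend vs (\<lambda>xs as. F (x # xs) (a # as)))" for x
      proof (rule module_hom_extend_family[OF E])
        fix xs :: "'x list" and as :: "'d list"
        assume "length xs = length vs" "length as = length vs"
        then show "module_hom sD sE (\<lambda>a. F (x # xs) (a # as))"
          using multilinearD[OF Cons.prems(1), of "x # xs" "0 # as" 0] by simp
      qed
      from module_hom_sum_over_supp[OF E this] show ?thesis by (simp add: 0)
    next
      case (Suc i)
      have "module_hom sT sE (\<lambda>v. extend (vs[i := v]) (\<lambda>xs as. F (x # xs) (coord x w # as)))" for x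
      proof (rule Cons.IH)
        fix xs :: "'x list" assume xs: "length xs = length vs"
        show "multilinear sD sE (length vs) (\<lambda>as. F (x # xs) (coord x w # as))"
          unfolding multilinear_def
        proof (intro allI impI)
          fix as :: "'d list" and m
          assume "length as = length vs" "m < length vs"
          then show "module_hom sD sE (\<lambda>v. F (x # xs) (coord x w # as[m := v]))"
            using multilinearD[OF Cons.prems(1), of "x # xs" "coord x w # as" "Suc m"] xs by simp
        qed
      qed (use Cons.prems Suc in simp)
      then show ?thesis by (simp add: Suc module_hom_sum' E T.module_axioms)
    qed
  qed simp
  with F show ?thesis unfolding multilinear_def by auto
qed

text \<open>
  If some \<open>a\<^sub>j = 0\<close>, the support of \<open>pure x\<^sub>j a\<^sub>j\<close> is empty and the left-hand side has no summands;
  then the right-hand side vanishes too, by multilinearity.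
\<close>

lemma extend_pure:
  assumes F: "\<And>xs. length xs = k \<Longrightarrow> multilinear sD sE k (F xs)"
    and len: "length xs = k" "length as = k"
  shows "extend (map2 pure xs as) F = F xs as"
  using assms
proof (induction k arbitrary: xs as F)
  case (Suc k)
  then obtain x xs' a as' where eq: "xs = x # xs'" "as = a # as'"
    and len: "length xs' = k" "length as' = k"
    by (metis length_Suc_conv)
  have IH: "extend (map2 pure xs' as') (\<lambda>us bs. F (y # us) (b # bs)) = F (y # xs') (b # as')" for y b
  proof (rule Suc.IH[OF _ len])
    fix us :: "'x list" assume us: "length us = k"
    show "multilinear sD sE k (\<lambda>bs. F (y # us) (b # bs))"
      unfolding multilinear_def
    proof (intro allI impI)
      fix bs :: "'d list" and m
      assume "length bs = k" "m < k"
      then show "module_hom sD sE (\<lambda>v. F (y # us) (b # bs[m := v]))"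
        using multilinearD[OF Suc.prems(1), of "y # us" "b # bs" "Suc m"] us by simp
    qed
  qed
  have "F (y # xs') (0 # as') = 0" for y
    using multilinear_zero_entry[OF Suc.prems(1), of "y # xs'" "0 # as'" 0] len by simp
  then show ?case
    unfolding eq using sum_over_supp_pure[where h = "\<lambda>y b. F (y # xs') (b # as')" and y = x and a = a]
    by (simp add: IH)
qed simp

end


section \<open>Segments and grafts\<close>

lemma length_seg: "i + l \<le> Suc (length as) \<Longrightarrow> 1 \<le> i \<Longrightarrow> length (seg i l as) = l"
  by (simp add: seg_def)

lemma length_graft:
  "1 \<le> i \<Longrightarrow> i \<le> k \<Longrightarrow> k + l = Suc (length as) \<Longrightarrow> length (graft i l as v) = k"
  by (simp add: graft_def)

lemma nth_seg:
  "i + l \<le> Suc (length as) \<Longrightarrow> 1 \<le> i \<Longrightarrow> j < l \<Longrightarrow> seg i l as ! j = as ! (i - 1 + j)"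
  by (simp add: seg_def)

lemma nth_graft:
  assumes "1 \<le> i" "i \<le> k" "k + l = Suc (length as)" "j < k"
  shows "graft i l as v ! j =
    (if j < i - 1 then as ! j else if j = i - 1 then v else as ! (j + l - 1))"
proof -
  have "j - i + (i + l - 1) = j + l - 1" if "i \<le> j"
    using that assms by simp
  then show ?thesis
    using assms by (auto simp: graft_def nth_append nth_Cons' min_def Suc_diff_le add.commute)
qed

lemma seg_map2:
  assumes "length xs = length as"
  shows "seg i l (map2 f xs as) = map2 f (seg i l xs) (seg i l as)"
  using assms by (simp add: seg_def take_map drop_map take_zip drop_zip)

lemma graft_map2:
  assumes "length xs = length as"
  shows "graft i l (map2 f xs as) (f x a) = map2 f (graft i l xs x) (graft i l as a)"
  using assms by (simp add: graft_def take_map drop_map take_zip drop_zip)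

lemma nth_list_update_total:
  "xs[i := x] ! j = (if i = j \<and> i < length xs then x else xs ! j)"
  by (cases "i < length xs") (auto simp: nth_list_update list_update_beyond)

lemma seg_list_update_outside:
  assumes "1 \<le> i" "j < i - 1 \<or> i + l - 1 \<le> j"
  shows "seg i l (as[j := v]) = seg i l as"
  using assms by (intro nth_equalityI) (auto simp: seg_def nth_list_update_total)

lemma seg_list_update_inside:
  assumes "1 \<le> i" "i - 1 \<le> j"
  shows "seg i l (as[j := v]) = (seg i l as)[j - (i - 1) := v]"
  using assms by (intro nth_equalityI) (auto simp: seg_def nth_list_update_total)

text \<open>
  The three lemmas below say where entry \<open>j\<close> of the original list ends up: before the block
  it keeps its index, inside the block it is seen only by \<open>seg\<close>, and behind the block its index drops
  by \<open>l - 1\<close>.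
\<close>

lemma graft_list_update_left:
  assumes "1 \<le> i" "i \<le> k" "k + l = Suc (length as)" "j < i - 1"
  shows "graft i l (as[j := v]) w = (graft i l as w)[j := v]"
  using assms
  by (intro nth_equalityI) (auto simp: length_graft nth_graft nth_list_update_total)

lemma graft_list_update_inside:
  assumes "1 \<le> i" "i \<le> k" "k + l = Suc (length as)" "i - 1 \<le> j" "j < i + l - 1"
  shows "graft i l (as[j := v]) w = graft i l as w"
  using assms
  by (intro nth_equalityI) (auto simp: length_graft[of i k] nth_graft[of i k] nth_list_update_total)

lemma graft_list_update_right:
  assumes "1 \<le> i" "i \<le> k" "k + l = Suc (length as)" "i + l - 1 \<le> j" "1 \<le> l"
  shows "graft i l (as[j := v]) w = (graft i l as w)[j + 1 - l := v]"
  using assms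
  by (intro nth_equalityI) (auto simp: length_graft[of i k] nth_graft[of i k] nth_list_update_total)

lemma graft_update_node:
  assumes "1 \<le> i" "i \<le> k" "k + l = Suc (length as)"
  shows "(graft i l as w)[i - 1 := v] = graft i l as v"
  using assms
  by (intro nth_equalityI) (auto simp: length_graft[of i k] nth_graft[of i k] nth_list_update_total)

lemma map2_commute: "map2 (\<lambda>a x. f x a) as xs = map2 f xs as"
  by (rule nth_equalityI) (auto simp: min.commute)

text \<open>
  The positions \<open>1, \<dots>, n\<close> of a composite operation are the positions of the outer operation
  with position \<open>i\<close> replaced by the \<open>l\<close> positions of the inner one.
\<close>

lemma sum_split_at_block:
  fixes f :: "nat \<Rightarrow> 'e::comm_monoid_add"
  assumes "1 \<le> i" "i \<le> k" "k + l = Suc n"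
  shows "(\<Sum>r = 1..n. f r) = (\<Sum>r = 1..<i. f r) + (\<Sum>s = 1..l. f (i - 1 + s)) + (\<Sum>r = Suc i..k. f (r + l - 1))"
proof -
  have "{1..n} = ({1..<i} \<union> {i..<i + l}) \<union> {i + l..n}" using assms by auto
  then have "(\<Sum>r = 1..n. f r) = (\<Sum>r = 1..<i. f r) + (\<Sum>r = i..<i + l. f r) + (\<Sum>r = i + l..n. f r)"
    by (simp only:) (subst sum.union_disjoint; auto)+
  also have "(\<Sum>r = i..<i + l. f r) = (\<Sum>s = 1..l. f (i - 1 + s))"
    by (rule sum.reindex_bij_witness[of _ "\<lambda>s. i - 1 + s" "\<lambda>r. r + 1 - i"]) (use assms in auto)
  also have "(\<Sum>r = i + l..n. f r) = (\<Sum>r = Suc i..k. f (r + l - 1))"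
    by (rule sum.reindex_bij_witness[of _ "\<lambda>r. r + l - 1" "\<lambda>r. r + 1 - l"]) (use assms in auto)
  finally show ?thesis .
qed

text \<open>
  Each entry is used exactly once, either directly by \<open>f\<close> or through \<open>g\<close>, whose value is itself a
  single entry of \<open>f\<close>.
\<close>

lemma multilinear_graft:
  assumes f: "multilinear sA sB k f" and g: "multilinear sA sA l g"
    and i: "1 \<le> i" "i \<le> k" "1 \<le> l" "k + l = Suc n"
  shows "multilinear sA sB n (\<lambda>as. f (graft i l as (g (seg i l as))))"
  unfolding multilinear_def
proof (intro allI impI)
  fix as :: "'b list" and j
  assume as: "length as = n" and j: "j < n"
  let ?g = "g (seg i l as)"
  have k: "k + l = Suc (length as)" using i as by simp
  consider "j < i - 1" | "i - 1 \<le> j" "j < i + l - 1" | "i + l - 1 \<le> j" by linarith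
  then show "module_hom sA sB (\<lambda>v. f (graft i l (as[j := v]) (g (seg i l (as[j := v])))))"
  proof cases
    case 1
    have "module_hom sA sB (\<lambda>v. f ((graft i l as ?g)[j := v]))"
      using i as 1 by (intro multilinearD[OF f]) (auto simp: length_graft)
    then show ?thesis
      using graft_list_update_left[OF i(1,2) k 1] 1 i(1) by (simp add: seg_list_update_outside)
  next
    case 2
    have "module_hom sA sA (\<lambda>v. g ((seg i l as)[j - (i - 1) := v]))"
      using i as 2 by (intro multilinearD[OF g]) (auto simp: length_seg)
    moreover have "module_hom sA sB (\<lambda>w. f ((graft i l as 0)[i - 1 := w]))"
      using i as by (intro multilinearD[OF f]) (auto simp: length_graft)
    ultimately show ?thesis
      using graft_list_update_inside[OF i(1,2) k 2] 2 i module_hom_compose[of sA sA _ sB]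
        graft_update_node[OF i(1,2) k]
      by (fastforce simp: seg_list_update_inside o_def)
  next
    case 3
    have "module_hom sA sB (\<lambda>v. f ((graft i l as ?g)[j + 1 - l := v]))"
      using i as 3 j by (intro multilinearD[OF f]) (auto simp: length_graft)
    then show ?thesis
      using graft_list_update_right[OF i(1,2) k 3 i(3)] 3 i(1) by (simp add: seg_list_update_outside)
  qed
qed


section \<open>Lists with one module entry\<close>

text \<open>
  Here \<open>q\<close> is a list index and so counts from 0, whereas \<open>r\<close> in \<open>rb_args P r\<close> counts from 1.
\<close>

definition mixed_at :: "nat \<Rightarrow> nat \<Rightarrow> ('a + 'm) list \<Rightarrow> bool" where
  "mixed_at n q zs \<longleftrightarrow> length zs = n \<and> q < n \<and> (\<forall>j<n. isl (zs ! j) \<longleftrightarrow> j \<noteq> q)"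

lemma mixed_iff_mixed_at: "mixed n zs \<longleftrightarrow> (\<exists>q. mixed_at n q zs)"
  unfolding mixed_def mixed_at_def by (auto simp: Ex1_def)

lemma isl_mixed_op: "isl (mixed_op \<mu> \<eta> l ws) \<longleftrightarrow> (\<forall>z\<in>set ws. isl z)"
  by (auto simp: mixed_op_def)

lemma mixed_multilinear_Inl:
  assumes "mixed_multilinear sA sM k f" "mixed_at k q ws" "j < k" "j \<noteq> q"
  shows "module_hom sA sM (\<lambda>a. f (ws[j := Inl a]))"
  using assms mixed_iff_mixed_at[of k ws] unfolding mixed_multilinear_def mixed_at_def by metis

lemma mixed_multilinear_Inr:
  assumes "mixed_multilinear sA sM k f" "mixed_at k q ws"
  shows "module_hom sM sM (\<lambda>u. f (ws[q := Inr u]))"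
  using assms mixed_iff_mixed_at[of k ws] unfolding mixed_multilinear_def mixed_at_def by metis

lemma all_isl_seg_outside:
  assumes "mixed_at n q zs" "1 \<le> i" "i + l \<le> Suc n" "q < i - 1 \<or> i + l - 1 \<le> q"
  shows "\<forall>z\<in>set (seg i l zs). isl z"
  using assms by (auto simp: in_set_conv_nth mixed_at_def length_seg nth_seg)

lemma mixed_at_seg_inside:
  assumes "mixed_at n q zs" "1 \<le> i" "i + l \<le> Suc n" "i - 1 \<le> q" "q < i + l - 1"
  shows "mixed_at l (q - (i - 1)) (seg i l zs)"
  using assms by (auto simp: mixed_at_def length_seg nth_seg)

lemma mixed_at_graft_outside:
  assumes "mixed_at n q zs" "1 \<le> i" "i \<le> k" "1 \<le> l" "k + l = Suc n" "isl w"
    and "q < i - 1 \<or> i + l - 1 \<le> q"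
  shows "mixed_at k (if q < i - 1 then q else q + 1 - l) (graft i l zs w)"
  using assms by (auto simp: mixed_at_def length_graft nth_graft)

lemma mixed_at_graft_inside:
  assumes "mixed_at n q zs" "1 \<le> i" "i \<le> k" "1 \<le> l" "k + l = Suc n" "\<not> isl w"
    and "i - 1 \<le> q" "q < i + l - 1"
  shows "mixed_at k (i - 1) (graft i l zs w)"
  using assms by (auto simp: mixed_at_def length_graft nth_graft)

text \<open>
  The analogue of \<open>multilinear_graft\<close> for the entries from the algebra. Whether the inner operation
  takes values in the algebra or in the module depends on whether the segment contains the
  module entry at \<open>q\<close>; this also determines where the module entry of the outer
  operation sits.
\<close>

lemma mixed_multilinear_graft:
  assumes \<mu>: "multilinear sA sA l (\<mu> l)"
    and \<eta>: "mixed_multilinear sA sM k (\<eta> k)" "mixed_multilinear sA sM l (\<eta> l)"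
    and i: "1 \<le> i" "i \<le> k" "1 \<le> l" "k + l = Suc n"
    and zs: "mixed_at n q zs" and j: "j < n" "j \<noteq> q"
  shows "module_hom sA sM (\<lambda>v. \<eta> k (graft i l (zs[j := Inl v]) (mixed_op \<mu> \<eta> l (seg i l (zs[j := Inl v])))))"
proof -
  let ?w = "mixed_op \<mu> \<eta> l (seg i l zs)"
  have len: "length zs = n" and q: "q < n" using zs by (auto simp: mixed_at_def)
  have k: "k + l = Suc (length zs)" using i len by simp
  have il: "i + l \<le> Suc n" using i by simp
  consider (left) "j < i - 1" | (mid) "i - 1 \<le> j" "j < i + l - 1" | (right) "i + l - 1 \<le> j" by linarith
  then show ?thesis
  proof cases
    case left
    obtain p where "mixed_at k p (graft i l zs ?w)" "j \<noteq> p"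
    proof (cases "q < i - 1 \<or> i + l - 1 \<le> q")
      case True
      then have "isl ?w" using all_isl_seg_outside[OF zs i(1) il] by (simp add: isl_mixed_op)
      from mixed_at_graft_outside[OF zs i this True] show ?thesis
        by (rule that) (use j left i True in \<open>auto split: if_splits\<close>)
    next
      case False
      then have "mixed_at l (q - (i - 1)) (seg i l zs)"
        by (intro mixed_at_seg_inside[OF zs i(1) il]) auto
      then have "\<not> isl ?w" unfolding isl_mixed_op mixed_at_def by (metis nth_mem)
      from mixed_at_graft_inside[OF zs i this] False show ?thesis
        by (intro that) (use left in auto)
    qed
    then have "module_hom sA sM (\<lambda>v. \<eta> k ((graft i l zs ?w)[j := Inl v]))"
      using left i by (intro mixed_multilinear_Inl[OF \<eta>(1)]) auto
    then show ?thesis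
      using graft_list_update_left[OF i(1,2) k left] left i(1) by (simp add: seg_list_update_outside)
  next
    case right
    obtain p where "mixed_at k p (graft i l zs ?w)" "j + 1 - l \<noteq> p"
    proof (cases "q < i - 1 \<or> i + l - 1 \<le> q")
      case True
      then have "isl ?w" using all_isl_seg_outside[OF zs i(1) il] by (simp add: isl_mixed_op)
      from mixed_at_graft_outside[OF zs i this True] show ?thesis
        by (rule that) (use j right i True in \<open>auto split: if_splits\<close>)
    next
      case False
      then have "mixed_at l (q - (i - 1)) (seg i l zs)"
        by (intro mixed_at_seg_inside[OF zs i(1) il]) auto
      then have "\<not> isl ?w" unfolding isl_mixed_op mixed_at_def by (metis nth_mem)
      from mixed_at_graft_inside[OF zs i this] False show ?thesis
        by (intro that) (use right i in auto)
    qed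
    then have "module_hom sA sM (\<lambda>v. \<eta> k ((graft i l zs ?w)[j + 1 - l := Inl v]))"
      using right i j by (intro mixed_multilinear_Inl[OF \<eta>(1)]) auto
    then show ?thesis
      using graft_list_update_right[OF i(1,2) k right i(3)] right i(1) by (simp add: seg_list_update_outside)
  next
    case mid
    let ?j = "j - (i - 1)"
    have seg: "seg i l (zs[j := Inl v]) = (seg i l zs)[?j := Inl v]" for v
      using mid i by (simp add: seg_list_update_inside)
    have graft: "graft i l (zs[j := Inl v]) w = (graft i l zs w')[i - 1 := w]" for v w w'
      using graft_list_update_inside[OF i(1,2) k mid] graft_update_node[OF i(1,2) k] by simp
    have lseg: "length (seg i l zs) = l" using len il i by (simp add: length_seg)
    show ?thesis
    proof (cases "q < i - 1 \<or> i + l - 1 \<le> q")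
      case True
      have isl: "\<forall>z\<in>set (seg i l zs). isl z" by (rule all_isl_seg_outside[OF zs i(1) il True])
      then have op: "mixed_op \<mu> \<eta> l ((seg i l zs)[?j := Inl v]) = Inl (\<mu> l ((map projl (seg i l zs))[?j := v]))" for v
        using set_update_subset_insert[of "seg i l zs" ?j "Inl v"]
        by (auto simp: mixed_op_def map_update)
      have "module_hom sA sA (\<lambda>v. \<mu> l ((map projl (seg i l zs))[?j := v]))"
        using mid i lseg by (intro multilinearD[OF \<mu>]) auto
      moreover have "module_hom sA sM (\<lambda>a. \<eta> k ((graft i l zs (Inl undefined))[i - 1 := Inl a]))"
        using mixed_at_graft_outside[OF zs i _ True, of "Inl undefined"] i True
        by (intro mixed_multilinear_Inl[OF \<eta>(1)]) (auto split: if_splits)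
      ultimately show ?thesis
        unfolding seg op graft[of _ _ "Inl undefined"]
        using module_hom_compose[of sA sA _ sM] by (fastforce simp: o_def)
    next
      case False
      then have m: "mixed_at l (q - (i - 1)) (seg i l zs)"
        by (intro mixed_at_seg_inside[OF zs i(1) il]) auto
      have ne: "?j \<noteq> q - (i - 1)" using j False mid by auto
      then have "(seg i l zs)[?j := Inl v] ! (q - (i - 1)) = seg i l zs ! (q - (i - 1))" for v
        by simp
      with m have "\<not> (\<forall>z\<in>set ((seg i l zs)[?j := Inl v]). isl z)" for v
        unfolding mixed_at_def by (metis length_list_update nth_mem)
      then have op: "mixed_op \<mu> \<eta> l ((seg i l zs)[?j := Inl v]) = Inr (\<eta> l ((seg i l zs)[?j := Inl v]))" for v
        by (simp add: mixed_op_def)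
      have "module_hom sA sM (\<lambda>v. \<eta> l ((seg i l zs)[?j := Inl v]))"
        using mid ne by (intro mixed_multilinear_Inl[OF \<eta>(2) m]) auto
      moreover have "module_hom sM sM (\<lambda>u. \<eta> k ((graft i l zs (Inr undefined))[i - 1 := Inr u]))"
        using mixed_at_graft_inside[OF zs i, of "Inr undefined"] False
        by (intro mixed_multilinear_Inr[OF \<eta>(1)]) auto
      ultimately show ?thesis
        unfolding seg op graft[of _ _ "Inr undefined"]
        using module_hom_compose[of sA sM _ sM] by (fastforce simp: o_def)
    qed
  qed
qed

lemma length_rb_args [simp]: "length (rb_args P r xs us) = min (length xs) (length us)"
  by (simp add: rb_args_def)

lemma nth_rb_args:
  "length xs = n \<Longrightarrow> length us = n \<Longrightarrow> j < n \<Longrightarrow>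
    rb_args P r xs us ! j = (if j = r - 1 then Inr (us ! j) else Inl (P (xs ! j) (us ! j)))"
  by (auto simp: rb_args_def nth_list_update)

lemma mixed_at_rb_args:
  "length xs = n \<Longrightarrow> length us = n \<Longrightarrow> 1 \<le> r \<Longrightarrow> r \<le> n \<Longrightarrow> mixed_at n (r - 1) (rb_args P r xs us)"
  by (auto simp: mixed_at_def nth_rb_args)

context
  fixes xs :: "'x list" and us :: "'m list" and n k l i :: nat
  assumes len: "length xs = n" "length us = n"
    and i: "1 \<le> i" "i \<le> k" "1 \<le> l" "k + l = Suc n"
begin

text \<open>
  The five lemmas below follow the module entry of \<open>rb_args P r xs us\<close> through \<open>seg\<close> and \<open>graft\<close>. If it
  lies in the block, the grafted value is a module element, and its letter \<open>y\<close> is arbitrary.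
\<close>

lemma seg_rb_args_outside:
  assumes "1 \<le> r" "r < i \<or> i + l \<le> r"
  shows "seg i l (rb_args P r xs us) = map Inl (map2 P (seg i l xs) (seg i l us))"
  using assms len i by (intro nth_equalityI) (auto simp: length_seg nth_seg nth_rb_args)

lemma seg_rb_args_inside:
  assumes "i \<le> r" "r < i + l"
  shows "seg i l (rb_args P r xs us) = rb_args P (r - i + 1) (seg i l xs) (seg i l us)"
  using assms len i
  by (intro nth_equalityI) (auto simp: length_seg nth_seg nth_rb_args[of _ l] nth_rb_args[of _ n])

lemma graft_rb_args_left:
  assumes "1 \<le> r" "r < i"
  shows "graft i l (rb_args P r xs us) (Inl (P y b)) = rb_args P r (graft i l xs y) (graft i l us b)"
  using assms len i
  by (intro nth_equalityI)
    (auto simp: length_graft[of i k] nth_graft[of i k] nth_rb_args[of _ n] nth_rb_args[of _ k])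

lemma graft_rb_args_inside:
  assumes "i \<le> r" "r < i + l"
  shows "graft i l (rb_args P r xs us) (Inr b) = rb_args P i (graft i l xs y) (graft i l us b)"
  using assms len i
  by (intro nth_equalityI)
    (auto simp: length_graft[of i k] nth_graft[of i k] nth_rb_args[of _ n] nth_rb_args[of _ k])

lemma graft_rb_args_right:
  assumes "i + l \<le> r" "r \<le> n"
  shows "graft i l (rb_args P r xs us) (Inl (P y b)) = rb_args P (r - l + 1) (graft i l xs y) (graft i l us b)"
  using assms len i
  by (intro nth_equalityI)
    (auto simp: length_graft[of i k] nth_graft[of i k] nth_rb_args[of _ n] nth_rb_args[of _ k])

end


section \<open>The algebra and bimodule of a homotopy matching dendriform algebra\<close>

locale dendriform_tensor =
  free_tensor_product sD sT tensor + D: homotopy_matching_dendriform sD G \<pi>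
  for sD :: "'k::comm_ring_1 \<Rightarrow> 'd::ab_group_add \<Rightarrow> 'd"
    and sT :: "'k \<Rightarrow> 't::ab_group_add \<Rightarrow> 't"
    and tensor :: "'d \<Rightarrow> ('x \<Rightarrow>\<^sub>0 'k) \<Rightarrow> 't"
    and G :: "int \<Rightarrow> 'd set"
    and \<pi> :: "nat \<Rightarrow> nat \<Rightarrow> 'x list \<Rightarrow> 'd list \<Rightarrow> 'd"
begin

abbreviation T_grading :: "int \<Rightarrow> 't set" where
  "T_grading \<equiv> tensor_grading sT tensor G degree_zero_grading"

lemma T_grading_eq: "T_grading i = T.span {pure x a |x a. a \<in> G i}"
  by (rule tensor_grading_eq_span_pure[OF D.graded_module_axioms])

lemma pure_in_T_grading: "a \<in> G i \<Longrightarrow> pure x a \<in> T_grading i"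
  unfolding T_grading_eq by (rule T.span_base) blast

lemma subspace_T_grading: "T.subspace (T_grading i)"
  by (simp add: tensor_grading_def)

lemma \<pi>_multilinear: "1 \<le> r \<Longrightarrow> r \<le> k \<Longrightarrow> length xs = k \<Longrightarrow> multilinear sD sD k (\<pi> k r xs)"
  using D.\<pi>_mem[of k] by (auto simp: operad_O_def)

lemma \<pi>_independent:
  "1 \<le> r \<Longrightarrow> r \<le> k \<Longrightarrow> length xs = k \<Longrightarrow> length as = k \<Longrightarrow> \<pi> k r (xs[r - 1 := y]) as = \<pi> k r xs as"
  using D.\<pi>_mem[of k] by (auto simp: operad_O_def)

lemma total_productsD:
  assumes "total_products sT tensor \<pi> \<mu>" "k \<ge> 1"
  shows "multilinear sT sT k (\<mu> k)"
    and "length xs = k \<Longrightarrow> length as = k \<Longrightarrow>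
      \<mu> k (map2 pure xs as) = (\<Sum>r = 1..k. pure (xs ! (r - 1)) (\<pi> k r xs as))"
  using assms unfolding total_products_def by (auto simp: map2_commute[of pure as xs, symmetric])

lemma total_actionsD:
  assumes "total_actions sT sD tensor \<pi> \<eta>" "k \<ge> 1"
  shows "mixed_multilinear sT sD k (\<eta> k)"
    and "1 \<le> r \<Longrightarrow> r \<le> k \<Longrightarrow> length xs = k \<Longrightarrow> length as = k \<Longrightarrow> \<eta> k (rb_args pure r xs as) = \<pi> k r xs as"
  using assms unfolding total_actions_def rb_args_def
  by (auto simp: map2_commute[of "\<lambda>x a. Inl (pure x a)" as xs, symmetric])

lemma total_products_exist: "\<exists>\<mu>. total_products sT tensor \<pi> \<mu>"
proof -
  define F where "F k xs as = (\<Sum>r = 1..k. pure (xs ! (r - 1)) (\<pi> k r xs as))" for k xs as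
  have F: "multilinear sD sT k (F k xs)" if "length xs = k" for k xs
    unfolding multilinear_def F_def
  proof (intro allI impI module_hom_sum' M.module_axioms T.module_axioms)
    fix as :: "'d list" and j r
    assume "length as = k" "j < k" "r \<in> {1..k}"
    then have "module_hom sD sD (\<lambda>v. \<pi> k r xs (as[j := v]))"
      using that by (intro multilinearD[OF \<pi>_multilinear]) auto
    from module_hom_compose[OF this module_hom_pure]
    show "module_hom sD sT (\<lambda>v. pure (xs ! (r - 1)) (\<pi> k r xs (as[j := v])))"
      by (simp add: o_def)
  qed
  have "total_products sT tensor \<pi> (\<lambda>k vs. extend vs (F k))"
    unfolding total_products_def
    using extend_multilinear[OF T.module_axioms F] extend_pure[OF F]
    by (auto simp: map2_commute[of pure] F_def)
  then show ?thesis by blast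
qed

text \<open>
  A module entry \<open>u\<close> is turned into \<open>u \<otimes> x\<^sub>0\<close> for a fixed \<open>x\<^sub>0\<close>, which reduces the actions to
  multilinear maps on \<open>D \<otimes> \<K>[X]\<close>. The choice of \<open>x\<^sub>0\<close> does not matter because \<open>(\<pi>\<^sub>k)\<^sup>[\<^sup>r\<^sup>]\<close> is
  independent of \<open>x\<^sub>r\<close>.
\<close>

lemma total_actions_exist: "\<exists>\<eta>. total_actions sT sD tensor \<pi> \<eta>"
proof -
  fix x0 :: 'x
  define pos :: "('t + 'd) list \<Rightarrow> nat" where "pos zs = length (takeWhile id (map isl zs))" for zs
  define conv :: "'t + 'd \<Rightarrow> 't" where "conv = case_sum id (pure x0)"
  define \<eta> where "\<eta> k zs = extend (map conv zs) (\<pi> k (Suc (pos zs)))" for k zs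
  have pos: "pos zs = q" if "mixed_at n q zs" for n q and zs :: "('t + 'd) list"
  proof -
    have "takeWhile id (map isl zs) = take q (map isl zs)"
      using that by (intro takeWhile_eq_take_P_nth) (auto simp: mixed_at_def)
    then show ?thesis using that by (simp add: pos_def mixed_at_def)
  qed
  have ext: "multilinear sT sD k (\<lambda>vs. extend vs (\<pi> k (Suc q)))" if "q < k" for k q
    using that by (intro extend_multilinear \<pi>_multilinear M.module_axioms) auto
  have "mixed_multilinear sT sD k (\<eta> k)" for k
    unfolding mixed_multilinear_def
  proof (intro allI impI)
    fix zs :: "('t + 'd) list" and j
    assume "mixed k zs" and j: "j < k"
    then obtain q where q: "mixed_at k q zs" by (auto simp: mixed_iff_mixed_at)
    then have len: "length zs = k" "q < k" by (auto simp: mixed_at_def)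
    have hom: "module_hom sT sD (\<lambda>v. extend ((map conv zs)[j := v]) (\<pi> k (Suc q)))"
      using len j by (intro multilinearD[OF ext]) auto
    have upd: "\<eta> k (zs[j := z]) = extend ((map conv zs)[j := conv z]) (\<pi> k (Suc q))"
      if "isl z = isl (zs ! j)" for z
    proof -
      have "mixed_at k q (zs[j := z])"
        using q that by (auto simp: mixed_at_def nth_list_update_total)
      from pos[OF this] show ?thesis by (simp add: \<eta>_def map_update)
    qed
    show "if isl (zs ! j) then module_hom sT sD (\<lambda>a. \<eta> k (zs[j := Inl a]))
      else module_hom sD sD (\<lambda>u. \<eta> k (zs[j := Inr u]))"
      using hom module_hom_compose[OF module_hom_pure hom]
      by (auto simp: upd conv_def o_def)
  qed
  moreover have "\<eta> k (rb_args pure r xs as) = \<pi> k r xs as"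
    if "1 \<le> r" "r \<le> k" "length xs = k" "length as = k" for k r xs as
  proof -
    have "map conv (rb_args pure r xs as) = map2 pure (xs[r - 1 := x0]) as"
      using that by (intro nth_equalityI) (auto simp: nth_rb_args[of _ k] conv_def nth_list_update)
    moreover have "pos (rb_args pure r xs as) = r - 1"
      using that by (intro pos mixed_at_rb_args)
    ultimately have "\<eta> k (rb_args pure r xs as) = extend (map2 pure (xs[r - 1 := x0]) as) (\<pi> k r)"
      using that by (simp add: \<eta>_def)
    also have "\<dots> = \<pi> k r (xs[r - 1 := x0]) as"
      by (intro extend_pure[where sE = sD and k = k] \<pi>_multilinear) (use that in auto)
    finally show ?thesis using that by (simp only: \<pi>_independent)
  qed
  ultimately have "total_actions sT sD tensor \<pi> \<eta>"
    unfolding total_actions_def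
    by (auto simp: rb_args_def map2_commute[of "\<lambda>x a. Inl (pure x a)"])
  then show ?thesis by blast
qed

text \<open>
  The subspace \<open>W\<close> is \<open>{0}\<close> when an identity is proved and a homogeneous component when a
  degree is computed.
\<close>

lemma pure_reduction:
  assumes \<Phi>: "multilinear sT sE n \<Phi>" and W: "module.subspace sE W"
    and base: "\<And>xs as. length xs = n \<Longrightarrow> length as = n \<Longrightarrow> homogeneous G as ds \<Longrightarrow> \<Phi> (map2 pure xs as) \<in> W"
    and vs: "length vs = n" "homogeneous T_grading vs ds"
  shows "\<Phi> vs \<in> W"
proof (rule entrywise_reduction[where R = "\<lambda>i z. z \<in> T_grading (ds ! i)"
      and S = "\<lambda>i z. z \<in> {pure x a |x a. a \<in> G (ds ! i)}" and Q = "\<lambda>zs. \<Phi> zs \<in> W"])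
  fix zs :: "'t list" and j
  assume "length zs = n" "j < n" "\<forall>i<n. zs ! i \<in> T_grading (ds ! i)"
    and upd: "\<And>z. z \<in> {pure x a |x a. a \<in> G (ds ! j)} \<Longrightarrow> \<Phi> (zs[j := z]) \<in> W"
  then have "module_hom sT sE (\<lambda>v. \<Phi> (zs[j := v]))" "zs ! j \<in> T.span {pure x a |x a. a \<in> G (ds ! j)}"
    by (auto intro!: multilinearD[OF \<Phi>] simp flip: T_grading_eq)
  from module_hom_span_into_subspace[OF this(1) W upd this(2)] show "\<Phi> zs \<in> W" by simp
next
  show "z \<in> {pure x a |x a. a \<in> G (ds ! i)} \<Longrightarrow> z \<in> T_grading (ds ! i)" for i z
    by (auto intro: pure_in_T_grading)
next
  have ds: "length ds = n" using vs by (auto simp: homogeneous_def dest: list_all2_lengthD)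
  fix zs :: "'t list"
  assume len: "length zs = n" and zs: "\<forall>i<n. zs ! i \<in> {pure x a |x a. a \<in> G (ds ! i)}"
  then have "\<forall>i. \<exists>x a. i < n \<longrightarrow> a \<in> G (ds ! i) \<and> zs ! i = pure x a" by blast
  then obtain x a where xa: "\<And>i. i < n \<Longrightarrow> a i \<in> G (ds ! i) \<and> zs ! i = pure (x i) (a i)" by metis
  have "zs = map2 pure (map x [0..<n]) (map a [0..<n])"
    using len xa by (intro nth_equalityI) auto
  moreover have "homogeneous G (map a [0..<n]) ds"
    using xa ds by (simp add: homogeneous_def list_all2_conv_all_nth)
  ultimately show "\<Phi> zs \<in> W" using base[of "map x [0..<n]" "map a [0..<n]"] by simp
next
  show "\<forall>i<n. vs ! i \<in> T_grading (ds ! i)"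
    using vs by (auto simp: homogeneous_def list_all2_conv_all_nth)
qed (rule vs)

text \<open>
  The entry at \<open>q\<close> is already a homogeneous element of \<open>D\<close>; only the other entries are reduced.
\<close>

lemma mixed_pure_reduction:
  assumes \<Phi>: "\<And>zs j. mixed_at n q zs \<Longrightarrow> j < n \<Longrightarrow> j \<noteq> q \<Longrightarrow> module_hom sT sE (\<lambda>v. \<Phi> (zs[j := Inl v]))"
    and W: "module.subspace sE W"
    and base: "\<And>xs as. length xs = n \<Longrightarrow> length as = n \<Longrightarrow> homogeneous G as ds \<Longrightarrow> \<Phi> (rb_args pure (Suc q) xs as) \<in> W"
    and vs: "mixed_at n q vs" "homogeneous (sum_grading T_grading G) vs ds"
  shows "\<Phi> vs \<in> W"
proof -
  let ?S = "\<lambda>i z. if i = q then z \<in> Inr ` G (ds ! i) else z \<in> Inl ` {pure x a |x a. a \<in> G (ds ! i)}"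
  let ?R = "\<lambda>i z. if i = q then z \<in> Inr ` G (ds ! i) else z \<in> Inl ` T_grading (ds ! i)"
  have q: "q < n" and len_vs: "length vs = n" using vs by (auto simp: mixed_at_def)
  have ds: "length ds = n" using vs by (auto simp: homogeneous_def mixed_at_def dest: list_all2_lengthD)
  have SR: "?S i z \<Longrightarrow> ?R i z" for i z
    by (auto intro: pure_in_T_grading split: if_splits)
  show ?thesis
  proof (rule entrywise_reduction[where R = ?R and S = ?S and Q = "\<lambda>zs. \<Phi> zs \<in> W", OF _ SR _ len_vs])
    fix zs :: "('t + 'd) list" and j
    assume zs: "length zs = n" "j < n" "\<forall>i<n. ?R i (zs ! i)"
      and upd: "\<And>z. ?S j z \<Longrightarrow> \<Phi> (zs[j := z]) \<in> W"
    show "\<Phi> zs \<in> W"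
    proof (cases "j = q")
      case True
      then show ?thesis using upd[of "zs ! j"] zs by auto
    next
      case False
      have "isl (zs ! i) \<longleftrightarrow> i \<noteq> q" if "i < n" for i
        using zs(3)[rule_format, OF that] by (auto split: if_splits)
      then have "mixed_at n q zs" using zs q by (simp add: mixed_at_def)
      then have hom: "module_hom sT sE (\<lambda>v. \<Phi> (zs[j := Inl v]))" using zs False by (intro \<Phi>)
      obtain v where v: "zs ! j = Inl v" "v \<in> T.span {pure x a |x a. a \<in> G (ds ! j)}"
        using zs False by (force simp flip: T_grading_eq)
      have "\<Phi> (zs[j := Inl v]) \<in> W"
        by (rule module_hom_span_into_subspace[OF hom W _ v(2)]) (use upd False in auto)
      then show ?thesis using v(1) by (metis list_update_id)
    qed
  next
    fix zs :: "('t + 'd) list"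
    assume len: "length zs = n" and zs: "\<forall>i<n. ?S i (zs ! i)"
    have "\<exists>x a. i < n \<longrightarrow> a \<in> G (ds ! i) \<and> zs ! i = (if i = q then Inr a else Inl (pure x a))" for i
    proof (cases "i < n")
      case True
      from zs[rule_format, OF this] show ?thesis by (auto split: if_splits)
    qed simp
    then obtain x a where xa: "\<And>i. i < n \<Longrightarrow> a i \<in> G (ds ! i) \<and> zs ! i = (if i = q then Inr (a i) else Inl (pure (x i) (a i)))"
      by metis
    have "zs = rb_args pure (Suc q) (map x [0..<n]) (map a [0..<n])"
      using len xa by (intro nth_equalityI) (auto simp: nth_rb_args[of _ n])
    moreover have "homogeneous G (map a [0..<n]) ds"
      using xa ds by (simp add: homogeneous_def list_all2_conv_all_nth)
    ultimately show "\<Phi> zs \<in> W" using base[of "map x [0..<n]" "map a [0..<n]"] by simp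
  next
    have isl: "isl (vs ! i) \<longleftrightarrow> i \<noteq> q" "vs ! i \<in> sum_grading T_grading G (ds ! i)" if "i < n" for i
      using vs that by (auto simp: homogeneous_def list_all2_conv_all_nth mixed_at_def)
    show "\<forall>i<n. ?R i (vs ! i)"
    proof (intro allI impI)
      fix i assume "i < n"
      with isl[OF this] show "?R i (vs ! i)"
        by (auto simp: sum_grading_def)
    qed
  qed
qed

text \<open>
  The double sum over the position \<open>s\<close> in the inner and the position \<open>r\<close> in the outer
  operation is split at \<open>r = i\<close>. Summands with \<open>r \<noteq> i\<close> carry a letter that does not depend on
  \<open>s\<close>, so that the sum over \<open>s\<close> moves inside; these are the outer two cases of the partial
  composition. Summands with \<open>r = i\<close> carry the letter \<open>x\<^bsub>i-1+s\<^esub>\<close> and give the middle case.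
\<close>

lemma product_composition:
  assumes \<mu>: "total_products sT tensor \<pi> \<mu>"
    and len: "length xs = n" "length as = n"
    and i: "1 \<le> i" "i \<le> k" "1 \<le> l" "k + l = Suc n"
  shows "\<mu> k (graft i l (map2 pure xs as) (\<mu> l (seg i l (map2 pure xs as))))
    = (\<Sum>r = 1..n. pure (xs ! (r - 1)) (partial_comp i (\<pi> k) l (\<pi> l) r xs as))"
proof -
  let ?x = "\<lambda>s. xs ! (i - 1 + s - 1)"
  let ?b = "\<lambda>s. \<pi> l s (seg i l xs) (seg i l as)"
  let ?zs = "map2 pure xs as"
  let ?X = "\<lambda>s. graft i l xs (?x s)" and ?A = "\<lambda>s. graft i l as (?b s)"
  have k: "1 \<le> k" using i by simp
  have kl: "k + l = Suc (length xs)" "k + l = Suc (length as)" using len i by auto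
  have "seg i l xs ! (s - 1) = ?x s" if "s \<in> {1..l}" for s
    using len i that by (auto simp: nth_seg intro!: arg_cong[of _ _ "(!) xs"])
  then have inner: "\<mu> l (seg i l ?zs) = (\<Sum>s = 1..l. pure (?x s) (?b s))"
    using len i by (simp add: seg_map2 total_productsD(2)[OF \<mu> i(3)] length_seg)
  interpret node: module_hom sT sT "\<lambda>v. \<mu> k ((graft i l ?zs 0)[i - 1 := v])"
    using len i by (intro multilinearD[OF total_productsD(1)[OF \<mu> k]]) (auto simp: length_graft)
  have node: "\<mu> k (graft i l ?zs v) = \<mu> k ((graft i l ?zs 0)[i - 1 := v])" for v
    using graft_update_node[OF i(1,2), of l ?zs 0 v] len i by simp
  have "\<mu> k (graft i l ?zs (\<mu> l (seg i l ?zs))) = (\<Sum>s = 1..l. \<mu> k (graft i l ?zs (pure (?x s) (?b s))))"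
    unfolding inner node by (rule node.sum)
  also have "\<dots> = (\<Sum>s = 1..l. \<Sum>r = 1..k. pure (?X s ! (r - 1)) (\<pi> k r (?X s) (?A s)))"
    using len i by (simp add: graft_map2[of xs as i l pure] total_productsD(2)[OF \<mu> k] length_graft[of i k])
  also have "\<dots> = (\<Sum>s = 1..l. (\<Sum>r = 1..<i. pure (xs ! (r - 1)) (\<pi> k r (?X s) (?A s)))
      + pure (?x s) (\<pi> k i (?X s) (?A s))
      + (\<Sum>r = Suc i..k. pure (xs ! (r + l - 1 - 1)) (\<pi> k r (?X s) (?A s))))"
  proof (rule sum.cong)
    fix s assume "s \<in> {1..l}"
    \<comment> \<open>A block of length 1 cuts the range at the grafting position alone.\<close>
    have "(\<Sum>r = 1..k. f r) = (\<Sum>r = 1..<i. f r) + f i + (\<Sum>r = Suc i..k. f r)" for f :: "nat \<Rightarrow> 't"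
      using sum_split_at_block[of i k 1 k f] i by simp
    then show "(\<Sum>r = 1..k. pure (?X s ! (r - 1)) (\<pi> k r (?X s) (?A s)))
      = (\<Sum>r = 1..<i. pure (xs ! (r - 1)) (\<pi> k r (?X s) (?A s)))
      + pure (?x s) (\<pi> k i (?X s) (?A s))
      + (\<Sum>r = Suc i..k. pure (xs ! (r + l - 1 - 1)) (\<pi> k r (?X s) (?A s)))"
      using i by (auto simp: nth_graft[OF i(1,2) kl(1)] intro!: arg_cong2[of _ _ _ _ "(+)"] sum.cong)
  qed simp
  also have "\<dots> = (\<Sum>r = 1..<i. pure (xs ! (r - 1)) (\<Sum>s = 1..l. \<pi> k r (?X s) (?A s)))
      + (\<Sum>s = 1..l. pure (?x s) (\<pi> k i (?X s) (?A s)))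
      + (\<Sum>r = Suc i..k. pure (xs ! (r + l - 1 - 1)) (\<Sum>s = 1..l. \<pi> k r (?X s) (?A s)))"
    unfolding sum.distrib pure.sum
    by (intro arg_cong2[of _ _ _ _ "(+)"] sum.swap refl)
  also have "\<dots> = (\<Sum>r = 1..<i. pure (xs ! (r - 1)) (partial_comp i (\<pi> k) l (\<pi> l) r xs as))
      + (\<Sum>s = 1..l. pure (xs ! (i - 1 + s - 1)) (partial_comp i (\<pi> k) l (\<pi> l) (i - 1 + s) xs as))
      + (\<Sum>r = Suc i..k. pure (xs ! (r + l - 1 - 1)) (partial_comp i (\<pi> k) l (\<pi> l) (r + l - 1) xs as))"
    using i by (intro arg_cong2[of _ _ _ _ "(+)"] sum.cong refl) (auto simp: partial_comp_def)
  also have "\<dots> = (\<Sum>r = 1..n. pure (xs ! (r - 1)) (partial_comp i (\<pi> k) l (\<pi> l) r xs as))"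
    by (rule sum_split_at_block[OF i(1,2,4), symmetric])
  finally show ?thesis .
qed

text \<open>
  If the module entry lies outside the block, the inner operation is \<open>\<mu>\<^sub>l\<close> and its sum over \<open>s\<close> is
  the sum in the partial composition. If it lies in the block, the inner operation is \<open>\<eta>\<^sub>l\<close>, a
  single term.
\<close>

lemma action_composition:
  assumes \<mu>: "total_products sT tensor \<pi> \<mu>" and \<eta>: "total_actions sT sD tensor \<pi> \<eta>"
    and len: "length xs = n" "length as = n"
    and i: "1 \<le> i" "i \<le> k" "1 \<le> l" "k + l = Suc n"
    and r: "1 \<le> r" "r \<le> n"
  shows "\<eta> k (graft i l (rb_args pure r xs as) (mixed_op \<mu> \<eta> l (seg i l (rb_args pure r xs as))))
    = partial_comp i (\<pi> k) l (\<pi> l) r xs as"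
proof -
  let ?x = "\<lambda>s. xs ! (i - 1 + s - 1)"
  let ?b = "\<lambda>s. \<pi> l s (seg i l xs) (seg i l as)"
  let ?zs = "rb_args pure r xs as"
  let ?X = "\<lambda>s. graft i l xs (?x s)" and ?A = "\<lambda>s. graft i l as (?b s)"
  have k: "1 \<le> k" using i by simp
  have il: "i + l \<le> Suc n" using i by simp
  have zs: "mixed_at n (r - 1) ?zs" using len r by (intro mixed_at_rb_args)
  have lX: "length (graft i l xs y) = k" "length (graft i l as b) = k" for y b
    using len i by (auto simp: length_graft[of i k])
  have lS: "length (seg i l xs) = l" "length (seg i l as) = l"
    using len i by (auto simp: length_seg)
  show ?thesis
  proof (cases "r < i \<or> i + l \<le> r")
    case out: True
    \<comment> \<open>The position of the module entry after the block has shrunk to one entry.\<close>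
    define p where "p = (if r < i then r else r - l + 1)"
    have p: "1 \<le> p" "p \<le> k" using r i out by (auto simp: p_def)
    have op: "mixed_op \<mu> \<eta> l (seg i l ?zs) = Inl (\<mu> l (map2 pure (seg i l xs) (seg i l as)))"
      using seg_rb_args_outside[OF len i r(1) out, of pure] by (simp add: mixed_op_def o_def)
    have "seg i l xs ! (s - 1) = ?x s" if "s \<in> {1..l}" for s
      using len i that by (auto simp: nth_seg intro!: arg_cong[of _ _ "(!) xs"])
    then have "\<mu> l (map2 pure (seg i l xs) (seg i l as)) = (\<Sum>s = 1..l. pure (?x s) (?b s))"
      using lS by (simp add: total_productsD(2)[OF \<mu> i(3)])
    with op have inner: "mixed_op \<mu> \<eta> l (seg i l ?zs) = Inl (\<Sum>s = 1..l. pure (?x s) (?b s))" by simp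
    have m: "mixed_at k (p - 1) (graft i l ?zs (Inl 0))"
    proof -
      have "r - 1 < i - 1 \<or> i + l - 1 \<le> r - 1" using r i out by auto
      from mixed_at_graft_outside[OF zs i _ this, of "Inl 0"]
      show ?thesis using out r i by (auto simp: p_def split: if_splits)
    qed
    interpret node: module_hom sT sD "\<lambda>v. \<eta> k ((graft i l ?zs (Inl 0))[i - 1 := Inl v])"
      using r i out by (intro mixed_multilinear_Inl[OF total_actionsD(1)[OF \<eta> k] m]) (auto simp: p_def)
    have node: "\<eta> k (graft i l ?zs (Inl v)) = \<eta> k ((graft i l ?zs (Inl 0))[i - 1 := Inl v])" for v
      using graft_update_node[OF i(1,2), of l ?zs "Inl 0" "Inl v"] len i by simp
    have "\<eta> k (graft i l ?zs (mixed_op \<mu> \<eta> l (seg i l ?zs)))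
        = (\<Sum>s = 1..l. \<eta> k (graft i l ?zs (Inl (pure (?x s) (?b s)))))"
      unfolding inner node by (rule node.sum)
    also have "\<dots> = (\<Sum>s = 1..l. \<eta> k (rb_args pure p (?X s) (?A s)))"
      using out graft_rb_args_left[OF len i r(1), of pure] graft_rb_args_right[OF len i _ r(2), of pure]
      by (auto simp: p_def)
    also have "\<dots> = (\<Sum>s = 1..l. \<pi> k p (?X s) (?A s))"
      using total_actionsD(2)[OF \<eta> k p lX] by simp
    also have "\<dots> = partial_comp i (\<pi> k) l (\<pi> l) r xs as"
      using out i by (auto simp: partial_comp_def p_def)
    finally show ?thesis .
  next
    case False
    then have ins: "i \<le> r" "r < i + l" by auto
    have seg: "seg i l ?zs = rb_args pure (r - i + 1) (seg i l xs) (seg i l as)"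
      by (rule seg_rb_args_inside[OF len i ins])
    have "mixed_at l (r - 1 - (i - 1)) (seg i l ?zs)"
      using ins i by (intro mixed_at_seg_inside[OF zs i(1) il]) auto
    then have "\<not> (\<forall>z\<in>set (seg i l ?zs). isl z)"
      unfolding mixed_at_def by (metis nth_mem)
    then have "mixed_op \<mu> \<eta> l (seg i l ?zs) = Inr (\<eta> l (seg i l ?zs))"
      by (simp add: mixed_op_def)
    also have "\<eta> l (seg i l ?zs) = ?b (r - i + 1)"
      unfolding seg using ins lS by (intro total_actionsD(2)[OF \<eta> i(3)]) auto
    finally have "\<eta> k (graft i l ?zs (mixed_op \<mu> \<eta> l (seg i l ?zs)))
        = \<eta> k (rb_args pure i (graft i l xs (xs ! (r - 1))) (graft i l as (?b (r - i + 1))))"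
      by (simp add: graft_rb_args_inside[OF len i ins, where y = "xs ! (r - 1)"])
    also have "\<dots> = \<pi> k i (graft i l xs (xs ! (r - 1))) (graft i l as (?b (r - i + 1)))"
      by (rule total_actionsD(2)[OF \<eta> k i(1,2) lX])
    also have "\<dots> = partial_comp i (\<pi> k) l (\<pi> l) r xs as"
      using ins by (simp add: partial_comp_def)
    finally show ?thesis .
  qed
qed

text \<open>
  On homogeneous elements \<open>a \<otimes> x\<close> the coefficient of each letter \<open>x\<^sub>r\<close> is the dendriform identity
  with upper index \<open>r\<close>.
\<close>

lemma total_products_a_infinity:
  assumes \<mu>: "total_products sT tensor \<pi> \<mu>"
  shows "a_infinity_algebra sT T_grading \<mu>"
proof (intro a_infinity_algebra.intro a_infinity_algebra_axioms.intro)
  show "graded_module sT T_grading"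
    by (rule graded_module_tensor[OF D.graded_module_axioms])
  show "multilinear sT sT k (\<mu> k)" if "k \<ge> 1" for k
    by (rule total_productsD(1)[OF \<mu> that])
  show "\<mu> k vs \<in> T_grading (sum_list ds + int k - 2)"
    if k: "k \<ge> 1" and vs: "length vs = k" "homogeneous T_grading vs ds" for k vs ds
  proof (rule pure_reduction[OF total_productsD(1)[OF \<mu> k] subspace_T_grading _ vs])
    fix xs :: "'x list" and as
    assume "length xs = k" "length as = k" "homogeneous G as ds"
    then show "\<mu> k (map2 pure xs as) \<in> T_grading (sum_list ds + int k - 2)"
      by (auto simp: total_productsD(2)[OF \<mu> k]
          intro!: T.subspace_sum[OF subspace_T_grading] pure_in_T_grading D.\<pi>_degree)
  qed
  show "(\<Sum>k = 1..n. let l = n + 1 - k in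
      \<Sum>i = 1..k. signed (stasheff_exponent i l ds) (\<mu> k (graft i l vs (\<mu> l (seg i l vs))))) = 0"
    (is "?\<Phi> vs = 0")
    if n: "n \<ge> 1" and vs: "length vs = n" "homogeneous T_grading vs ds" for n vs ds
  proof -
    have lin: "multilinear sT sT n ?\<Phi>"
      unfolding multilinear_def Let_def
    proof (intro allI impI module_hom_sum' T.module_axioms module_hom_signed)
      fix ws :: "'t list" and j k i
      assume *: "length ws = n" "j < n" "k \<in> {1..n}" "i \<in> {1..k}"
      show "module_hom sT sT (\<lambda>v. \<mu> k (graft i (n + 1 - k) (ws[j := v]) (\<mu> (n + 1 - k) (seg i (n + 1 - k) (ws[j := v])))))"
        by (rule multilinearD[OF multilinear_graft[OF total_productsD(1)[OF \<mu>] total_productsD(1)[OF \<mu>]]])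
          (use * in auto)
    qed
    have "?\<Phi> (map2 pure xs as) \<in> {0}"
      if len: "length xs = n" "length as = n" and as: "homogeneous G as ds" for xs as
    proof -
      let ?c = "\<lambda>k i r. partial_comp i (\<pi> k) (n + 1 - k) (\<pi> (n + 1 - k)) r xs as"
      let ?e = "\<lambda>k i. stasheff_exponent i (n + 1 - k) ds"
      have "?\<Phi> (map2 pure xs as) = (\<Sum>k = 1..n. \<Sum>i = 1..k. \<Sum>r = 1..n. signed (?e k i) (pure (xs ! (r - 1)) (?c k i r)))"
        unfolding Let_def signed_sum[symmetric]
        using len by (intro sum.cong refl arg_cong[of _ _ "signed _"] product_composition[OF \<mu>]) auto
      \<comment> \<open>The range of \<open>r\<close> does not depend on \<open>k\<close> and \<open>i\<close>, so the letter can be made the outermost index.\<close>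
      also have "\<dots> = (\<Sum>r = 1..n. \<Sum>k = 1..n. \<Sum>i = 1..k. signed (?e k i) (pure (xs ! (r - 1)) (?c k i r)))"
        by (subst sum.swap, subst (2) sum.swap, rule refl)
      also have "\<dots> = (\<Sum>r = 1..n. pure (xs ! (r - 1)) (\<Sum>k = 1..n. \<Sum>i = 1..k. signed (?e k i) (?c k i r)))"
        by (simp add: pure.sum signed_def if_distrib[of "pure _"] pure.neg cong: if_cong)
      also have "\<dots> = 0"
        using D.\<pi>_identity[OF _ _ len as] by (simp add: Let_def pure.zero)
      finally show ?thesis by simp
    qed
    from pure_reduction[OF lin T.subspace_single_0 this vs] show ?thesis by simp
  qed
qed

text \<open>
  With the module entry at list index \<open>q\<close>, the bimodule identity on elements \<open>a \<otimes> x\<close> is the dendriform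
  identity with upper index \<open>q + 1\<close>.
\<close>

lemma total_actions_bimodule:
  assumes \<mu>: "total_products sT tensor \<pi> \<mu>" and \<eta>: "total_actions sT sD tensor \<pi> \<eta>"
  shows "a_infinity_bimodule sT T_grading \<mu> sD G \<eta>"
proof (intro a_infinity_bimodule.intro a_infinity_bimodule_axioms.intro
    total_products_a_infinity[OF \<mu>] D.graded_module_axioms)
  show "mixed_multilinear sT sD k (\<eta> k)" if "k \<ge> 1" for k
    by (rule total_actionsD(1)[OF \<eta> that])
  show "\<eta> k zs \<in> G (sum_list ds + int k - 2)"
    if k: "k \<ge> 1" and zs: "mixed k zs" "homogeneous (sum_grading T_grading G) zs ds" for k zs ds
  proof -
    obtain q where q: "mixed_at k q zs" using zs by (auto simp: mixed_iff_mixed_at)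
    show ?thesis
    proof (rule mixed_pure_reduction[OF _ D.subspace_G _ q zs(2)])
      show "module_hom sT sD (\<lambda>v. \<eta> k (ws[j := Inl v]))" if "mixed_at k q ws" "j < k" "j \<noteq> q" for ws j
        using that by (rule mixed_multilinear_Inl[OF total_actionsD(1)[OF \<eta> k]])
      fix xs :: "'x list" and as
      assume "length xs = k" "length as = k" "homogeneous G as ds"
      moreover have "Suc q \<le> k" using q by (simp add: mixed_at_def)
      ultimately show "\<eta> k (rb_args pure (Suc q) xs as) \<in> G (sum_list ds + int k - 2)"
        by (simp add: total_actionsD(2)[OF \<eta> k] D.\<pi>_degree)
    qed
  qed
  show "(\<Sum>k = 1..n. let l = n + 1 - k in
      \<Sum>i = 1..k. signed (stasheff_exponent i l ds)
        (\<eta> k (graft i l zs (mixed_op \<mu> \<eta> l (seg i l zs))))) = 0" (is "?\<Phi> zs = 0")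
    if n: "n \<ge> 1" and zs: "mixed n zs" "homogeneous (sum_grading T_grading G) zs ds" for n zs ds
  proof -
    obtain q where q: "mixed_at n q zs" using zs by (auto simp: mixed_iff_mixed_at)
    have "?\<Phi> zs \<in> {0}"
    proof (rule mixed_pure_reduction[where \<Phi> = ?\<Phi>, OF _ M.subspace_single_0 _ q zs(2)])
      show "module_hom sT sD (\<lambda>v. ?\<Phi> (ws[j := Inl v]))" if ws: "mixed_at n q ws" "j < n" "j \<noteq> q" for ws j
        unfolding Let_def
      proof (intro module_hom_sum' T.module_axioms M.module_axioms module_hom_signed)
        fix k i assume "k \<in> {1..n}" "i \<in> {1..k}"
        then show "module_hom sT sD (\<lambda>v. \<eta> k (graft i (n + 1 - k) (ws[j := Inl v])
            (mixed_op \<mu> \<eta> (n + 1 - k) (seg i (n + 1 - k) (ws[j := Inl v])))))"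
          by (intro mixed_multilinear_graft[OF _ _ _ _ _ _ _ ws] total_productsD(1)[OF \<mu>]
              total_actionsD(1)[OF \<eta>]) auto
      qed
      fix xs :: "'x list" and as
      assume len: "length xs = n" "length as = n" and as: "homogeneous G as ds"
      have r: "1 \<le> Suc q" "Suc q \<le> n" using q by (auto simp: mixed_at_def)
      have "?\<Phi> (rb_args pure (Suc q) xs as) = (\<Sum>k = 1..n. let l = n + 1 - k in
            \<Sum>i = 1..k. signed (stasheff_exponent i l ds) (partial_comp i (\<pi> k) l (\<pi> l) (Suc q) xs as))"
        unfolding Let_def
        using len r by (intro sum.cong refl arg_cong[of _ _ "signed _"] action_composition[OF \<mu> \<eta>]) auto
      also have "\<dots> = 0" by (rule D.\<pi>_identity[OF r len as])
      finally show "?\<Phi> (rb_args pure (Suc q) xs as) \<in> {0}" by simp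
    qed
    then show ?thesis by simp
  qed
qed

lemma pure_rota_baxter:
  assumes \<mu>: "total_products sT tensor \<pi> \<mu>" and \<eta>: "total_actions sT sD tensor \<pi> \<eta>"
  shows "homotopy_matching_relative_rota_baxter sT T_grading \<mu> sD G \<eta> pure"
proof (intro homotopy_matching_relative_rota_baxter.intro
    homotopy_matching_relative_rota_baxter_axioms.intro total_actions_bimodule[OF \<mu> \<eta>]
    module_hom_pure pure_in_T_grading)
  fix k and xs :: "'x list" and us :: "'d list"
  assume "k \<ge> 1" "length xs = k" "length us = k"
  then show "\<mu> k (map2 pure xs us) = (\<Sum>r = 1..k. pure (xs ! (r - 1)) (\<eta> k (rb_args pure r xs us)))"
    by (simp add: total_productsD(2)[OF \<mu>] total_actionsD(2)[OF \<eta>])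
qed

lemma induced_dendriform_eq:
  assumes "total_actions sT sD tensor \<pi> \<eta>"
    and "1 \<le> r" "r \<le> k" "length xs = k" "length us = k"
  shows "induced_dendriform \<eta> pure k r xs us = \<pi> k r xs us"
  unfolding induced_dendriform_def using assms by (intro total_actionsD(2)) auto

end

theorem theorem6p12:
  fixes sD :: "'k::comm_ring_1 \<Rightarrow> 'd::ab_group_add \<Rightarrow> 'd"
    and G :: "int \<Rightarrow> 'd set"
    and \<pi> :: "nat \<Rightarrow> nat \<Rightarrow> 'x list \<Rightarrow> 'd list \<Rightarrow> 'd"
    and sT :: "'k \<Rightarrow> 't::ab_group_add \<Rightarrow> 't"
    and tensor :: "'d \<Rightarrow> ('x \<Rightarrow>\<^sub>0 'k) \<Rightarrow> 't"
  assumes "CHAR('k) \<noteq> 2"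
    and "homotopy_matching_dendriform sD G \<pi>"
    and "tensor_product sD free_scale sT tensor"
  shows
    "(\<exists>\<mu>. total_products sT tensor \<pi> \<mu>) \<and>
     (\<exists>\<eta>. total_actions sT sD tensor \<pi> \<eta>) \<and>
     (\<forall>\<mu>. total_products sT tensor \<pi> \<mu> \<longrightarrow>
        a_infinity_algebra sT (tensor_grading sT tensor G degree_zero_grading) \<mu> \<and>
        (\<forall>\<eta>. total_actions sT sD tensor \<pi> \<eta> \<longrightarrow>
           a_infinity_bimodule sT (tensor_grading sT tensor G degree_zero_grading) \<mu> sD G \<eta> \<and>
           homotopy_matching_relative_rota_baxter
             sT (tensor_grading sT tensor G degree_zero_grading) \<mu> sD G \<eta>
             (\<lambda>x a. tensor a (Poly_Mapping.single x 1)) \<and>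
           (\<forall>k r xs us. 1 \<le> r \<longrightarrow> r \<le> k \<longrightarrow> length xs = k \<longrightarrow> length us = k \<longrightarrow>
              induced_dendriform \<eta> (\<lambda>x a. tensor a (Poly_Mapping.single x 1)) k r xs us
                = \<pi> k r xs us)))"
proof -
  interpret tensor_product sD free_scale sT tensor by fact
  interpret homotopy_matching_dendriform sD G \<pi> by fact
  interpret dendriform_tensor sD sT tensor G \<pi> ..
  show ?thesis
    using total_products_exist total_actions_exist total_products_a_infinity
      total_actions_bimodule pure_rota_baxter induced_dendriform_eq by blast
qed

end
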